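(* Let $G \in \mathscr{S}$ be such that $\mathcal{LC}(G) \neq \{0, \infty\}$. Then $G$ contains a non-abelian discrete free subsemigroup.
   Context: $\mathscr{S}$ is the class of non-discrete, compactly generated, topologically simple, totally disconnected locally compact groups (topologically simple: non-trivial, and the only closed normal subgroups are $\{1\}$ and the whole group). A subgroup of $G$ is locally normal if its normaliser in $G$ is open. The structure lattice $\mathcal{LN}(G)$ is the set of closed locally normal subgroups of $G$ modulo $H \sim K$ iff $H \cap K$ is open in both $H$ and $K$; the class of $H$ is $[H]$; $0$ is the class of $\{1\}$ and $\infty$ the class of compact open subgroups. For $G \in \mathscr{S}$, the centraliser lattice is $\mathcal{LC}(G) = \{[\mathrm{C}_G(K)] : K \text{ a closed locally normal subgroup of } G\} \subseteq \mathcal{LN}(G)$. *)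

theory Defs
  imports "HOL-Analysis.Analysis" "HOL-Algebra.Generated_Groups" "HOL-Algebra.Group_Action"
begin

locale topological_group = group G for G (structure) +
  fixes T :: "'a topology"
  assumes topspace_eq_carrier: "topspace T = carrier G"
    and continuous_mult: "continuous_map (prod_topology T T) T (\<lambda>(x, y). x \<otimes> y)"
    and continuous_inv: "continuous_map T T (\<lambda>x. inv x)"

definition totally_disconnected_space :: "'a topology \<Rightarrow> bool" where
  "totally_disconnected_space T \<longleftrightarrow> (\<forall>S. connectedin T S \<longrightarrow> (\<exists>a. S \<subseteq> {a}))"

(* Locally compact groups are Hausdorff by convention. *)
definition tdlc_group :: "('a, 'b) monoid_scheme \<Rightarrow> 'a topology \<Rightarrow> bool" where
  "tdlc_group G T \<longleftrightarrow> topological_group G T \<and> Hausdorff_space T \<and>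
     locally_compact_space T \<and> totally_disconnected_space T"

definition compactly_generated :: "('a, 'b) monoid_scheme \<Rightarrow> 'a topology \<Rightarrow> bool" where
  "compactly_generated G T \<longleftrightarrow> (\<exists>K. compactin T K \<and> generate G K = carrier G)"

definition topologically_simple :: "('a, 'b) monoid_scheme \<Rightarrow> 'a topology \<Rightarrow> bool" where
  "topologically_simple G T \<longleftrightarrow> carrier G \<noteq> {\<one>\<^bsub>G\<^esub>} \<and>
     (\<forall>N. N \<lhd> G \<and> closedin T N \<longrightarrow> N = {\<one>\<^bsub>G\<^esub>} \<or> N = carrier G)"

definition class_S :: "('a, 'b) monoid_scheme \<Rightarrow> 'a topology \<Rightarrow> bool" where
  "class_S G T \<longleftrightarrow> tdlc_group G T \<and> T \<noteq> discrete_topology (carrier G) \<and>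
     compactly_generated G T \<and> topologically_simple G T"

definition closed_locally_normal :: "('a, 'b) monoid_scheme \<Rightarrow> 'a topology \<Rightarrow> 'a set set" where
  "closed_locally_normal G T =
     {H. subgroup H G \<and> closedin T H \<and> openin T (normalizer G H)}"

definition commensurate :: "('a, 'b) monoid_scheme \<Rightarrow> 'a topology \<Rightarrow> ('a set \<times> 'a set) set" where
  "commensurate G T = {(H, K). H \<in> closed_locally_normal G T \<and> K \<in> closed_locally_normal G T \<and>
     openin (subtopology T H) (H \<inter> K) \<and> openin (subtopology T K) (H \<inter> K)}"

definition structure_lattice :: "('a, 'b) monoid_scheme \<Rightarrow> 'a topology \<Rightarrow> 'a set set set" where
  "structure_lattice G T = closed_locally_normal G T // commensurate G T"

definition lattice_class :: "('a, 'b) monoid_scheme \<Rightarrow> 'a topology \<Rightarrow> 'a set \<Rightarrow> 'a set set" where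
  "lattice_class G T H = commensurate G T `` {H}"

definition lattice_zero :: "('a, 'b) monoid_scheme \<Rightarrow> 'a topology \<Rightarrow> 'a set set" where
  "lattice_zero G T = lattice_class G T {\<one>\<^bsub>G\<^esub>}"

(* Any two compact open subgroups are commensurate, and a totally disconnected locally compact
   group has at least one, so this union of classes is the single class they all share. *)
definition lattice_infinity :: "('a, 'b) monoid_scheme \<Rightarrow> 'a topology \<Rightarrow> 'a set set" where
  "lattice_infinity G T =
     (\<Union>U \<in> {U. subgroup U G \<and> compactin T U \<and> openin T U}. lattice_class G T U)"

definition centralizer :: "('a, 'b) monoid_scheme \<Rightarrow> 'a set \<Rightarrow> 'a set" where
  "centralizer G K = {g \<in> carrier G. \<forall>k\<in>K. g \<otimes>\<^bsub>G\<^esub> k = k \<otimes>\<^bsub>G\<^esub> g}"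

definition centralizer_lattice :: "('a, 'b) monoid_scheme \<Rightarrow> 'a topology \<Rightarrow> 'a set set set" where
  "centralizer_lattice G T =
     {lattice_class G T (centralizer G K) | K. K \<in> closed_locally_normal G T}"

definition subsemigroup :: "('a, 'b) monoid_scheme \<Rightarrow> 'a set \<Rightarrow> bool" where
  "subsemigroup G S \<longleftrightarrow> S \<subseteq> carrier G \<and> (\<forall>x\<in>S. \<forall>y\<in>S. x \<otimes>\<^bsub>G\<^esub> y \<in> S)"

(* The free semigroup on X consists of the nonempty words over X; S is free on X when
   evaluation of words in G is a bijection, hence an isomorphism, from it onto S. *)
definition free_subsemigroup :: "('a, 'b) monoid_scheme \<Rightarrow> 'a set \<Rightarrow> bool" where
  "free_subsemigroup G S \<longleftrightarrow> subsemigroup G S \<and>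
     (\<exists>X\<subseteq>S. bij_betw (\<lambda>ws. foldr (\<otimes>\<^bsub>G\<^esub>) ws \<one>\<^bsub>G\<^esub>) (lists X - {[]}) S)"

definition nonabelian :: "('a, 'b) monoid_scheme \<Rightarrow> 'a set \<Rightarrow> bool" where
  "nonabelian G S \<longleftrightarrow> (\<exists>x\<in>S. \<exists>y\<in>S. x \<otimes>\<^bsub>G\<^esub> y \<noteq> y \<otimes>\<^bsub>G\<^esub> x)"

definition discrete_subset :: "'a topology \<Rightarrow> 'a set \<Rightarrow> bool" where
  "discrete_subset T S \<longleftrightarrow> subtopology T S = discrete_topology S"

end

(* Write C for centralisers. First, G has no non-trivial abelian locally normal subgroup A: finitely
   many conjugates of A generate G together with a compact open subgroup, so inside a small open
   subgroup they generate a subgroup B that every element of G commensurates, and the elements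
   centralising an open part of B would form a non-trivial normal subset; compact generation turns
   this into a non-trivial normal subgroup of G inside a compact open one. Hence the locally normal
   subgroups with C(C(H)) = H form a Boolean algebra on which G acts with open stabilisers.

   Every non-trivial locally normal subgroup has a conjugate meeting a fixed compact set K that
   avoids 1 (conjugate until it leaves a compact open subgroup for the first time). Each element of K
   moves some b in the algebra off itself, and finitely many b serve for all of K. An element of a
   that moves b off itself forces b to lie below a, so finitely many b can be conjugated into any
   non-zero a, and one of them, b say, can be conjugated into every non-zero a below b. As there are
   no atoms, two conjugates of b are disjoint and contained in b; the conjugating elements play
   ping-pong on b. Distinct words move b differently, so the semigroup is discrete because the
   stabiliser of b is open. *)

theory Submission
  imports Defs
begin

section \<open>Conjugation in groups\<close>

context group
begin

definition cj :: "'a \<Rightarrow> 'a \<Rightarrow> 'a" where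
  "cj g x = g \<otimes> x \<otimes> inv g"

lemma mult_inv_cancel [simp]:
  assumes "x \<in> carrier G" "y \<in> carrier G"
  shows "x \<otimes> (inv x \<otimes> y) = y" "inv x \<otimes> (x \<otimes> y) = y"
  using assms by (simp_all add: m_assoc[symmetric])

lemma cj_closed [simp]: "g \<in> carrier G \<Longrightarrow> x \<in> carrier G \<Longrightarrow> cj g x \<in> carrier G"
  by (simp add: cj_def)

lemma cj_mult:
  "g \<in> carrier G \<Longrightarrow> x \<in> carrier G \<Longrightarrow> y \<in> carrier G \<Longrightarrow> cj g (x \<otimes> y) = cj g x \<otimes> cj g y"
  by (simp add: cj_def m_assoc)

lemma cj_cj:
  "g \<in> carrier G \<Longrightarrow> h \<in> carrier G \<Longrightarrow> x \<in> carrier G \<Longrightarrow> cj g (cj h x) = cj (g \<otimes> h) x"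
  by (simp add: cj_def m_assoc inv_mult_group)

lemma cj_inv: "g \<in> carrier G \<Longrightarrow> x \<in> carrier G \<Longrightarrow> cj g (inv x) = inv (cj g x)"
  by (simp add: cj_def m_assoc inv_mult_group)

lemma cj_by_one [simp]: "x \<in> carrier G \<Longrightarrow> cj \<one> x = x"
  by (simp add: cj_def)

lemma cj_one [simp]: "g \<in> carrier G \<Longrightarrow> cj g \<one> = \<one>"
  by (simp add: cj_def)

lemma cj_inv_cancel [simp]:
  assumes "g \<in> carrier G" "x \<in> carrier G"
  shows "cj g (cj (inv g) x) = x" "cj (inv g) (cj g x) = x"
  using assms by (simp_all add: cj_cj)

lemma cj_inj: "g \<in> carrier G \<Longrightarrow> x \<in> carrier G \<Longrightarrow> y \<in> carrier G \<Longrightarrow> cj g x = cj g y \<longleftrightarrow> x = y"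
  by (metis cj_inv_cancel(2))

lemma cj_eq_one_iff [simp]: "g \<in> carrier G \<Longrightarrow> x \<in> carrier G \<Longrightarrow> cj g x = \<one> \<longleftrightarrow> x = \<one>"
  by (metis cj_inj cj_one one_closed)

lemma cj_eq_iff_commute:
  "g \<in> carrier G \<Longrightarrow> x \<in> carrier G \<Longrightarrow> cj g x = x \<longleftrightarrow> g \<otimes> x = x \<otimes> g"
  by (simp add: cj_def inv_solve_right')

lemma cj_eq_sym:
  "g \<in> carrier G \<Longrightarrow> x \<in> carrier G \<Longrightarrow> cj g x = x \<longleftrightarrow> cj x g = g"
  by (auto simp: cj_eq_iff_commute)

lemma commutator_eq_one_iff:
  "g \<in> carrier G \<Longrightarrow> x \<in> carrier G \<Longrightarrow> cj g x \<otimes> inv x = \<one> \<longleftrightarrow> cj g x = x"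
  by (simp add: inv_solve_right')

text \<open>The left side lies in any subgroup that contains \<open>x\<close> and is normalised by
  \<open>g\<close>, the right side in any that contains \<open>g\<close> and is normalised by
  \<open>x\<close>. Together they put commutators into intersections.\<close>

lemma commutator_alt:
  "g \<in> carrier G \<Longrightarrow> x \<in> carrier G \<Longrightarrow> cj g x \<otimes> inv x = g \<otimes> cj x (inv g)"
  by (simp add: cj_def m_assoc)

lemma cj_subgroup_closed: "subgroup H G \<Longrightarrow> g \<in> H \<Longrightarrow> x \<in> H \<Longrightarrow> cj g x \<in> H"
  by (simp add: cj_def subgroup.m_closed subgroup.m_inv_closed)

section \<open>Images of subgroups under conjugation\<close>

lemma mem_cj_image:
  assumes "H \<subseteq> carrier G" "g \<in> carrier G" "x \<in> carrier G"
  shows "x \<in> cj g ` H \<longleftrightarrow> cj (inv g) x \<in> H"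
proof
  assume "x \<in> cj g ` H"
  then show "cj (inv g) x \<in> H"
    using assms by (auto simp: subset_iff)
next
  assume "cj (inv g) x \<in> H"
  then show "x \<in> cj g ` H"
    using assms by (intro image_eqI[of _ _ "cj (inv g) x"]) auto
qed

lemma cj_image_subset: "H \<subseteq> carrier G \<Longrightarrow> g \<in> carrier G \<Longrightarrow> cj g ` H \<subseteq> carrier G"
  by auto

lemma cj_image_cj_image:
  assumes "H \<subseteq> carrier G" "g \<in> carrier G" "h \<in> carrier G"
  shows "cj g ` cj h ` H = cj (g \<otimes> h) ` H"
  unfolding image_image using assms by (intro image_cong) (auto simp: cj_cj)

lemma cj_image_one [simp]: "H \<subseteq> carrier G \<Longrightarrow> cj \<one> ` H = H"
  by (force simp: image_iff)

lemma cj_image_inv_cancel [simp]: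
  assumes "H \<subseteq> carrier G" "g \<in> carrier G"
  shows "cj g ` cj (inv g) ` H = H" "cj (inv g) ` cj g ` H = H"
  using assms by (simp_all add: cj_image_cj_image)

lemma cj_image_Int:
  assumes "H \<subseteq> carrier G" "K \<subseteq> carrier G" "g \<in> carrier G"
  shows "cj g ` (H \<inter> K) = cj g ` H \<inter> cj g ` K"
proof -
  have "inj_on (cj g) (carrier G)"
    by (rule inj_onI) (simp add: cj_inj assms)
  then show ?thesis
    using assms by (simp add: inj_on_image_Int)
qed

lemma cj_image_trivial_iff [simp]:
  assumes "H \<subseteq> carrier G" "g \<in> carrier G"
  shows "cj g ` H = {\<one>} \<longleftrightarrow> H = {\<one>}"
  using cj_image_inv_cancel(2)[OF assms] assms by fastforce

lemma subgroup_cj_image: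
  assumes "subgroup H G" "g \<in> carrier G"
  shows "subgroup (cj g ` H) G"
proof (rule subgroupI)
  show "cj g ` H \<subseteq> carrier G"
    using assms subgroup.subset[OF assms(1)] by auto
  show "cj g ` H \<noteq> {}"
    using subgroup.one_closed[OF assms(1)] by blast
  have H: "H \<subseteq> carrier G"
    by (rule subgroup.subset[OF assms(1)])
  fix a assume "a \<in> cj g ` H"
  then obtain x where x: "x \<in> H" "a = cj g x" by blast
  then show "inv a \<in> cj g ` H"
    using assms H by (auto simp: cj_inv[symmetric] subgroup.m_inv_closed)
  fix b assume "b \<in> cj g ` H"
  then obtain y where y: "y \<in> H" "b = cj g y" by blast
  have "a \<otimes> b = cj g (x \<otimes> y)"
    using x y assms H by (metis cj_mult subsetD)
  then show "a \<otimes> b \<in> cj g ` H"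
    using x y assms by (simp add: subgroup.m_closed)
qed

lemma subgroup_Int: "subgroup H G \<Longrightarrow> subgroup K G \<Longrightarrow> subgroup (H \<inter> K) G"
  by (rule subgroups_Inter_pair)

lemma subgroup_eq_trivial_iff: "subgroup H G \<Longrightarrow> H = {\<one>} \<longleftrightarrow> (\<forall>x\<in>H. x = \<one>)"
  using subgroup.one_closed by fastforce

section \<open>Centralisers\<close>

lemma mem_centralizer_iff:
  assumes "H \<subseteq> carrier G"
  shows "x \<in> centralizer G H \<longleftrightarrow> x \<in> carrier G \<and> (\<forall>h\<in>H. cj x h = h)"
  using assms by (auto simp: centralizer_def cj_eq_iff_commute subset_iff)

lemma centralizer_subset: "centralizer G H \<subseteq> carrier G"
  by (auto simp: centralizer_def)

lemma centralizer_antimono: "H \<subseteq> K \<Longrightarrow> centralizer G K \<subseteq> centralizer G H"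
  by (auto simp: centralizer_def)

lemma subset_centralizer_iff:
  "H \<subseteq> carrier G \<Longrightarrow> K \<subseteq> carrier G \<Longrightarrow> K \<subseteq> centralizer G H \<longleftrightarrow> H \<subseteq> centralizer G K"
  by (auto simp: centralizer_def subset_iff)

lemma subset_double_centralizer: "H \<subseteq> carrier G \<Longrightarrow> H \<subseteq> centralizer G (centralizer G H)"
  by (auto simp: centralizer_def subset_iff)

lemma triple_centralizer:
  "H \<subseteq> carrier G \<Longrightarrow> centralizer G (centralizer G (centralizer G H)) = centralizer G H"
  by (meson centralizer_antimono centralizer_subset equalityI subset_double_centralizer)

lemma subgroup_centralizer:
  assumes "H \<subseteq> carrier G"
  shows "subgroup (centralizer G H) G"
proof (rule subgroupI)
  show "centralizer G H \<noteq> {}"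
    using assms by (auto simp: centralizer_def subset_iff intro!: exI[of _ \<one>])
  fix a assume a: "a \<in> centralizer G H"
  then show "inv a \<in> centralizer G H"
    using assms unfolding mem_centralizer_iff[OF assms]
    by (metis cj_inv_cancel(2) inv_closed subsetD)
  fix b assume "b \<in> centralizer G H"
  with a show "a \<otimes> b \<in> centralizer G H"
    using assms by (auto simp: mem_centralizer_iff[OF assms] cj_cj[symmetric] subset_iff)
qed (rule centralizer_subset)

lemma centralizer_cj_image:
  assumes "H \<subseteq> carrier G" "g \<in> carrier G"
  shows "centralizer G (cj g ` H) = cj g ` centralizer G H"
proof -
  have *: "x \<in> centralizer G (cj g ` H) \<longleftrightarrow> cj (inv g) x \<in> centralizer G H" if x: "x \<in> carrier G" for x
  proof -
    have "cj x (cj g h) = cj g h \<longleftrightarrow> cj (cj (inv g) x) h = h" if "h \<in> H" for h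
    proof -
      have h: "h \<in> carrier G" using that assms by blast
      have "cj (cj (inv g) x) h = cj (inv g) (cj x (cj g h))"
        using x h assms by (simp add: cj_def m_assoc inv_mult_group)
      then show ?thesis
        using x h assms by (metis cj_closed cj_inv_cancel)
    qed
    then show ?thesis
      using assms x by (simp add: mem_centralizer_iff cj_image_subset)
  qed
  show ?thesis
  proof (rule Set.set_eqI)
    fix x
    show "x \<in> centralizer G (cj g ` H) \<longleftrightarrow> x \<in> cj g ` centralizer G H"
    proof (cases "x \<in> carrier G")
      case True
      then show ?thesis
        using * assms by (simp add: mem_cj_image centralizer_subset)
    next
      case False
      then show ?thesis
        using assms centralizer_subset cj_image_subset by blast
    qed
  qed
qed

text \<open>Inverses of generators need their own hypothesis because \<open>cj x\<close> might map
  \<open>S\<close> properly into itself.\<close>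

lemma generate_cj_invariant:
  assumes "X \<subseteq> carrier G" "S \<subseteq> carrier G"
    and "\<And>x s. x \<in> X \<Longrightarrow> s \<in> S \<Longrightarrow> cj x s \<in> S"
    and "\<And>x s. x \<in> X \<Longrightarrow> s \<in> S \<Longrightarrow> cj (inv x) s \<in> S"
    and "g \<in> generate G X" "s \<in> S"
  shows "cj g s \<in> S"
  using assms(5,6)
proof (induction g arbitrary: s rule: generate.induct)
  case one
  then show ?case using assms(2) by auto
next
  case (eng h1 h2)
  then have "h1 \<in> carrier G" "h2 \<in> carrier G" "s \<in> carrier G"
    using generate_in_carrier[OF assms(1)] assms(2) by auto
  then show ?case
    using eng by (simp add: cj_cj[symmetric])
qed (use assms in auto)

lemma cj_by_cj:
  assumes "g \<in> carrier G" "c \<in> carrier G" "h \<in> carrier G"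
  shows "cj (cj g c) h = cj g (cj c (cj (inv g) h))"
  using assms by (simp add: cj_def m_assoc inv_mult_group)

lemma cj_cj_swap:
  assumes "g \<in> carrier G" "v \<in> carrier G" "h \<in> carrier G"
  shows "cj g (cj v h) = cj (cj g v) (cj g h)"
  using assms by (simp add: cj_def m_assoc inv_mult_group)

text \<open>Induction over \<open>\<B>\<close>, starting from \<open>D = W\<close>. If
  \<open>D\<close> meets the next \<open>N\<close> non-trivially, \<open>D \<inter> N\<close>
  serves, as \<open>N\<close> is abelian; otherwise commutators of \<open>D\<close> and
  \<open>N\<close>, both normalised by \<open>W\<close>, lie in
  \<open>D \<inter> N = {\<one>}\<close>, and \<open>D\<close> itself serves.\<close>

lemma common_centralizing_subgroup:
  assumes W: "subgroup W G" "W \<noteq> {\<one>}" and "finite \<B>"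
    and "\<forall>N\<in>\<B>. subgroup N G \<and> N \<subseteq> W \<and> (\<forall>w\<in>W. \<forall>x\<in>N. cj w x \<in> N) \<and> (\<forall>x\<in>N. \<forall>y\<in>N. cj x y = y)"
  shows "\<exists>D. subgroup D G \<and> D \<subseteq> W \<and> D \<noteq> {\<one>} \<and> (\<forall>w\<in>W. \<forall>x\<in>D. cj w x \<in> D) \<and>
    (\<forall>N\<in>\<B>. \<forall>x\<in>N. \<forall>d\<in>D. cj d x = x)"
  using assms(3,4)
proof (induction \<B> rule: finite_induct)
  case empty
  then show ?case
    using W by (intro exI[of _ W]) (auto intro: cj_subgroup_closed)
next
  case (insert N \<B>)
  have "\<exists>D. subgroup D G \<and> D \<subseteq> W \<and> D \<noteq> {\<one>} \<and> (\<forall>w\<in>W. \<forall>x\<in>D. cj w x \<in> D) \<and>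
    (\<forall>N\<in>\<B>. \<forall>x\<in>N. \<forall>d\<in>D. cj d x = x)"
    using insert.prems by (intro insert.IH) simp
  then obtain D where D: "subgroup D G" "D \<subseteq> W" "D \<noteq> {\<one>}" "\<forall>w\<in>W. \<forall>x\<in>D. cj w x \<in> D"
    "\<forall>N\<in>\<B>. \<forall>x\<in>N. \<forall>d\<in>D. cj d x = x"
    by (elim exE conjE)
  have N: "subgroup N G" "N \<subseteq> W" "\<And>w x. w \<in> W \<Longrightarrow> x \<in> N \<Longrightarrow> cj w x \<in> N"
    "\<And>x y. x \<in> N \<Longrightarrow> y \<in> N \<Longrightarrow> cj x y = y"
    using insert.prems by simp_all
  have WG: "W \<subseteq> carrier G" by (rule subgroup.subset[OF W(1)])
  show ?case
  proof (cases "D \<inter> N = {\<one>}")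
    case False
    then show ?thesis
      using D N by (intro exI[of _ "D \<inter> N"]) (auto intro: subgroup_Int)
  next
    case True
    have "cj d x = x" if x: "x \<in> N" and d: "d \<in> D" for x d
    proof -
      have G: "x \<in> carrier G" "d \<in> carrier G" using x d D(2) N(2) WG by auto
      have "cj d x \<otimes> inv x \<in> N"
        using N(3)[of d x] x d D(2) N(1) by (auto intro: subgroup.m_closed subgroup.m_inv_closed)
      moreover have "d \<otimes> cj x (inv d) \<in> D"
        using D(4) x d N(2) D(1) by (auto intro: subgroup.m_closed subgroup.m_inv_closed)
      ultimately have "cj d x \<otimes> inv x = \<one>"
        using commutator_alt[of d x] G True by auto
      then show ?thesis using G commutator_eq_one_iff by simp
    qed
    then show ?thesis
      using D by (intro exI[of _ D]) auto
  qed
qed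

end

section \<open>Open subgroups\<close>

lemma compactin_finite_subcover:
  assumes "compactin X K" "\<And>i. i \<in> I \<Longrightarrow> openin X (f i)" "K \<subseteq> (\<Union>i\<in>I. f i)"
  shows "\<exists>J. finite J \<and> J \<subseteq> I \<and> K \<subseteq> (\<Union>i\<in>J. f i)"
proof -
  have "\<exists>\<F>. finite \<F> \<and> \<F> \<subseteq> f ` I \<and> K \<subseteq> \<Union>\<F>"
    using assms(2,3) by (intro compactinD[OF assms(1)]) auto
  then obtain \<F> where \<F>: "finite \<F>" "\<F> \<subseteq> f ` I" "K \<subseteq> \<Union>\<F>"
    by (elim exE conjE)
  from finite_subset_image[OF \<F>(1,2)] obtain J where "J \<subseteq> I" "finite J" "\<F> = f ` J"
    by (elim exE conjE)
  with \<F>(3) show ?thesis by (intro exI[of _ J]) simp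
qed

definition open_subgroup :: "('a, 'b) monoid_scheme \<Rightarrow> 'a topology \<Rightarrow> 'a set \<Rightarrow> bool" where
  "open_subgroup G T V \<longleftrightarrow> subgroup V G \<and> openin T V"

section \<open>Continuity of the group operations\<close>

context topological_group
begin

lemma continuous_map_mult:
  assumes "continuous_map X T f" "continuous_map X T g"
  shows "continuous_map X T (\<lambda>x. f x \<otimes> g x)"
  using continuous_map_compose[OF continuous_map_pairedI[OF assms] continuous_mult]
  by (simp add: o_def)

lemma continuous_map_inverse:
  "continuous_map X T f \<Longrightarrow> continuous_map X T (\<lambda>x. inv (f x))"
  using continuous_map_compose[OF _ continuous_inv] by (simp add: o_def)

lemma continuous_map_cj:
  "continuous_map X T f \<Longrightarrow> continuous_map X T g \<Longrightarrow> continuous_map X T (\<lambda>x. cj (f x) (g x))"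
  unfolding cj_def by (intro continuous_map_mult continuous_map_inverse)

lemma continuous_map_group_const: "g \<in> carrier G \<Longrightarrow> continuous_map X T (\<lambda>x. g)"
  by (simp add: topspace_eq_carrier)

lemma continuous_map_cj_left: "g \<in> carrier G \<Longrightarrow> continuous_map T T (cj g)"
  using continuous_map_cj[OF continuous_map_group_const continuous_map_id] by (simp add: id_def)

lemma openin_preimage:
  assumes "continuous_map T T f" "openin T W"
  shows "openin T {x \<in> carrier G. f x \<in> W}"
  using openin_continuous_map_preimage[OF assms] by (simp add: topspace_eq_carrier)

lemma closedin_preimage:
  assumes "continuous_map T T f" "closedin T W"
  shows "closedin T {x \<in> carrier G. f x \<in> W}"
  using closedin_continuous_map_preimage[OF assms] by (simp add: topspace_eq_carrier)

lemma cj_image_eq_preimage: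
  "H \<subseteq> carrier G \<Longrightarrow> g \<in> carrier G \<Longrightarrow> cj g ` H = {x \<in> carrier G. cj (inv g) x \<in> H}"
  using mem_cj_image[of H g] cj_image_subset[of H g] by (intro Set.set_eqI) (metis mem_Collect_eq subsetD)

lemma openin_cj_image: "openin T W \<Longrightarrow> g \<in> carrier G \<Longrightarrow> openin T (cj g ` W)"
  using openin_subset[of T W] topspace_eq_carrier
  by (subst cj_image_eq_preimage) (auto intro: openin_preimage continuous_map_cj_left)

lemma openin_left_translate:
  assumes "openin T W" "g \<in> carrier G"
  shows "openin T ((\<otimes>) g ` W)"
proof -
  have W: "W \<subseteq> carrier G"
    using assms openin_subset topspace_eq_carrier by blast
  have "x \<in> (\<otimes>) g ` W" if "x \<in> carrier G" "inv g \<otimes> x \<in> W" for x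
    using that assms by (intro image_eqI[of _ _ "inv g \<otimes> x"]) auto
  then have "(\<otimes>) g ` W = {x \<in> carrier G. inv g \<otimes> x \<in> W}"
    using W assms by (auto simp: subset_iff)
  then show ?thesis
    using assms by (auto intro!: openin_preimage continuous_map_mult continuous_map_group_const)
qed

text \<open>The tube lemma: for a good \<open>x\<close> the slice \<open>K \<times> {x}\<close> lies
  in an open set of the product, which then contains a tube around it.\<close>

lemma openin_forall_compact:
  assumes K: "compactin T K" and W: "openin T W"
    and f: "continuous_map (prod_topology T T) T (\<lambda>(u, x). f u x)"
  shows "openin T {x \<in> carrier G. \<forall>u\<in>K. f u x \<in> W}"
proof (subst openin_subopen, clarify)
  fix x assume x: "x \<in> carrier G" "\<forall>u\<in>K. f u x \<in> W"
  let ?P = "{p \<in> topspace (prod_topology T T). (\<lambda>(u, x). f u x) p \<in> W}"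
  have K': "K \<subseteq> carrier G"
    using K compactin_subset_topspace topspace_eq_carrier by blast
  have "openin (prod_topology T T) ?P"
    by (rule openin_continuous_map_preimage[OF f W])
  moreover have "K \<times> {x} \<subseteq> ?P"
    using x K' by (auto simp: topspace_eq_carrier)
  ultimately obtain A B where AB: "openin T A" "openin T B" "K \<subseteq> A" "x \<in> B" "A \<times> B \<subseteq> ?P"
    using tube_lemma_left[of T T ?P K x] K x(1) topspace_eq_carrier by auto
  then show "\<exists>B. openin T B \<and> x \<in> B \<and> B \<subseteq> {x \<in> carrier G. \<forall>u\<in>K. f u x \<in> W}"
    using openin_subset[OF AB(2)] by (intro exI[of _ B]) (auto simp: topspace_eq_carrier subset_iff)
qed

section \<open>Open subgroups, cores and cosets\<close>

abbreviation OS :: "'a set \<Rightarrow> bool" where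
  "OS \<equiv> open_subgroup G T"

lemma OS_subgroup: "OS V \<Longrightarrow> subgroup V G"
  and OS_openin: "OS V \<Longrightarrow> openin T V"
  by (simp_all add: open_subgroup_def)

lemma OS_subset: "OS V \<Longrightarrow> V \<subseteq> carrier G"
  by (simp add: OS_subgroup subgroup.subset)

lemma OS_carrier: "OS (carrier G)"
  unfolding open_subgroup_def using openin_topspace[of T] topspace_eq_carrier subgroup_self by simp

lemma OS_Int: "OS V \<Longrightarrow> OS W \<Longrightarrow> OS (V \<inter> W)"
  by (simp add: open_subgroup_def subgroup_Int openin_Int)

lemma OS_finite_INT:
  assumes "finite I" "\<And>i. i \<in> I \<Longrightarrow> OS (V i)"
  shows "\<exists>W. OS W \<and> (\<forall>i\<in>I. W \<subseteq> V i)"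
  using assms
proof (induction I rule: finite_induct)
  case empty
  then show ?case using OS_carrier by blast
next
  case (insert i I)
  then obtain W where "OS W" "\<forall>i\<in>I. W \<subseteq> V i" by auto
  then show ?case
    using insert by (intro exI[of _ "W \<inter> V i"]) (auto intro: OS_Int)
qed

lemma OS_cj_image: "OS V \<Longrightarrow> g \<in> carrier G \<Longrightarrow> OS (cj g ` V)"
  by (simp add: open_subgroup_def subgroup_cj_image openin_cj_image)

text \<open>\<open>H\<close> is a union of left cosets of \<open>V\<close>.\<close>

lemma OS_supergroup:
  assumes "OS V" "V \<subseteq> H" "subgroup H G"
  shows "OS H"
proof -
  have "openin T H"
  proof (subst openin_subopen, intro ballI)
    fix h assume h: "h \<in> H"
    then have hG: "h \<in> carrier G" using assms(3) subgroup.subset by blast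
    have "h \<in> (\<otimes>) h ` V"
      using hG subgroup.one_closed[OF OS_subgroup[OF assms(1)]] by (force simp: image_iff)
    moreover have "(\<otimes>) h ` V \<subseteq> H"
      using h assms by (auto intro: subgroup.m_closed)
    ultimately show "\<exists>W. openin T W \<and> h \<in> W \<and> W \<subseteq> H"
      using openin_left_translate[OF OS_openin[OF assms(1)] hG] by blast
  qed
  then show ?thesis using assms by (simp add: open_subgroup_def)
qed

lemma OS_closedin:
  assumes "OS V"
  shows "closedin T V"
proof -
  have "openin T (carrier G - V)"
  proof (subst openin_subopen, intro ballI)
    fix h assume h: "h \<in> carrier G - V"
    have "h \<in> (\<otimes>) h ` V"
      using h subgroup.one_closed[OF OS_subgroup[OF assms(1)]] by (force simp: image_iff)
    moreover have "h \<otimes> v \<notin> V" if "v \<in> V" for v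
    proof
      assume "h \<otimes> v \<in> V"
      then have "h \<otimes> v \<otimes> inv v \<in> V"
        using that OS_subgroup[OF assms] by (simp add: subgroup.m_closed subgroup.m_inv_closed)
      then show False using h that OS_subset[OF assms] by (auto simp: m_assoc subset_iff)
    qed
    ultimately show "\<exists>W. openin T W \<and> h \<in> W \<and> W \<subseteq> carrier G - V"
      using openin_left_translate[OF OS_openin[OF assms(1)], of h] h OS_subset[OF assms] 
      by (intro exI[of _ "(\<otimes>) h ` V"]) auto
  qed
  then show ?thesis
    using OS_subset[OF assms] by (simp add: closedin_def topspace_eq_carrier)
qed

text \<open>For subgroups \<open>U\<close> and \<open>V\<close> this is the intersection of the
  \<open>U\<close>-conjugates of \<open>V\<close>; with \<open>U = carrier G\<close> it is the
  normal core.\<close>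

definition core_in :: "'a set \<Rightarrow> 'a set \<Rightarrow> 'a set" where
  "core_in U V = {x \<in> carrier G. \<forall>u\<in>U. cj u x \<in> V}"

lemma core_in_subset: "\<one> \<in> U \<Longrightarrow> core_in U V \<subseteq> V"
  by (auto simp: core_in_def)

lemma cj_core_in:
  assumes "subgroup U G" "u \<in> U" "x \<in> core_in U V"
  shows "cj u x \<in> core_in U V"
  using assms subgroup.subset[OF assms(1)]
  by (auto simp: core_in_def subset_iff cj_cj subgroup.m_closed)

lemma subgroup_core_in:
  assumes U: "U \<subseteq> carrier G" and V: "subgroup V G"
  shows "subgroup (core_in U V) G"
proof (rule subgroupI)
  show "core_in U V \<noteq> {}"
    using assms by (auto simp: core_in_def subset_iff subgroup.one_closed intro!: exI[of _ \<one>])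
  fix x assume x: "x \<in> core_in U V"
  then show "inv x \<in> core_in U V"
    using U V by (auto simp: core_in_def subset_iff cj_inv subgroup.m_inv_closed)
  fix y assume "y \<in> core_in U V"
  with x show "x \<otimes> y \<in> core_in U V"
    using U V by (auto simp: core_in_def subset_iff cj_mult subgroup.m_closed)
qed (auto simp: core_in_def)

lemma OS_core_in:
  assumes U: "compactin T U" and V: "OS V"
  shows "OS (core_in U V)"
proof -
  have "continuous_map (prod_topology T T) T (\<lambda>(u, x). cj u x)"
    unfolding case_prod_unfold by (intro continuous_map_cj continuous_map_fst continuous_map_snd)
  then have "openin T (core_in U V)"
    unfolding core_in_def by (rule openin_forall_compact[OF U OS_openin[OF V]])
  then show ?thesis
    using subgroup_core_in[OF _ OS_subgroup[OF V], of U] compactin_subset_topspace[OF U] topspace_eq_carrier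
    by (simp add: open_subgroup_def)
qed

lemma finite_cosets_compact:
  assumes U: "compactin T U" and V: "OS V"
  shows "\<exists>E. finite E \<and> E \<subseteq> U \<and> U \<subseteq> (\<Union>e\<in>E. (\<otimes>) e ` V)"
proof -
  have UG: "U \<subseteq> carrier G"
    using U compactin_subset_topspace topspace_eq_carrier by blast
  have "u \<in> (\<otimes>) u ` V" if "u \<in> U" for u
    using that UG subgroup.one_closed[OF OS_subgroup[OF V]] by (force simp: image_iff)
  then have "U \<subseteq> (\<Union>e\<in>U. (\<otimes>) e ` V)" by blast
  then show ?thesis
    using UG by (intro compactin_finite_subcover[OF U] openin_left_translate[OF OS_openin[OF V]]) auto
qed

end

section \<open>Compact open subgroups\<close>

locale tdlc = topological_group +
  assumes Hausdorff: "Hausdorff_space T"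
    and locally_compact: "locally_compact_space T"
    and totally_disconnected: "totally_disconnected_space T"
begin

lemma closedin_centralizer:
  assumes "H \<subseteq> carrier G"
  shows "closedin T (centralizer G H)"
proof (cases "H = {}")
  case True
  then show ?thesis
    using closedin_topspace[of T] by (simp add: centralizer_def topspace_eq_carrier)
next
  case False
  have "closedin T {x \<in> topspace T. x \<otimes> h = h \<otimes> x}" if "h \<in> H" for h
    using that assms by (intro closedin_continuous_maps_eq[OF Hausdorff] continuous_map_mult continuous_map_group_const) auto
  then have "closedin T (\<Inter>h\<in>H. {x \<in> topspace T. x \<otimes> h = h \<otimes> x})"
    using False by blast
  also have "(\<Inter>h\<in>H. {x \<in> topspace T. x \<otimes> h = h \<otimes> x}) = centralizer G H"
    using False by (auto simp: centralizer_def topspace_eq_carrier)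
  finally show ?thesis .
qed

text \<open>The component of \<open>\<one>\<close> is a point, so \<open>\<one>\<close> has a
  compact open neighbourhood \<open>P\<close> inside \<open>N\<close>; the elements that translate
  \<open>P\<close> onto itself form an open subgroup inside \<open>P\<close>.\<close>

theorem van_Dantzig:
  assumes "openin T N" "\<one> \<in> N"
  shows "\<exists>V. OS V \<and> compactin T V \<and> V \<subseteq> N"
proof -
  have one: "\<one> \<in> topspace T"
    by (simp add: topspace_eq_carrier)
  have "\<exists>U K. openin T U \<and> compactin T K \<and> \<one> \<in> U \<and> U \<subseteq> K"
    using locally_compact one unfolding locally_compact_space_def by (rule bspec)
  then obtain U K where UK: "openin T U" "compactin T K" "\<one> \<in> U" "U \<subseteq> K"
    by (elim exE conjE)
  have "connected_component_of_set T \<one> = {\<one>}"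
  proof -
    obtain a where "connected_component_of_set T \<one> \<subseteq> {a}"
      using totally_disconnected connectedin_connected_component_of[of T \<one>]
      unfolding totally_disconnected_space_def by metis
    moreover have "\<one> \<in> connected_component_of_set T \<one>"
      using one by (simp add: connected_component_of_refl)
    ultimately show ?thesis by blast
  qed
  then have comp: "{\<one>} \<in> connected_components_of T"
    using one by (metis connected_component_in_connected_components_of)
  obtain P Q where PQ: "openin T P" "openin T Q" "disjnt P Q" "P \<union> Q = topspace T" "{\<one>} \<subseteq> P" "P \<subseteq> N \<inter> U"
    using wilder_locally_compact_component_thm[OF locally_compact Hausdorff comp, of "N \<inter> U"]
      assms UK one by (auto simp: openin_Int)
  have "P = topspace T - Q"
    using PQ(3,4) by (auto simp: disjnt_def)
  then have "closedin T P"
    using PQ(2) by blast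
  then have P: "compactin T P"
    using closed_compactin[OF UK(2)] PQ(6) UK(4) by blast
  have PG: "P \<subseteq> carrier G"
    using PQ(4) by (auto simp: topspace_eq_carrier)
  \<comment> \<open>\<open>A\<close> is the monoid of left translations that map \<open>P\<close>
    into itself, and \<open>V\<close> its group of units; evaluating at
    \<open>\<one> \<in> P\<close> gives \<open>V \<subseteq> P\<close>.\<close>
  define A where "A = {x \<in> carrier G. \<forall>p\<in>P. x \<otimes> p \<in> P}"
  define V where "V = A \<inter> {x \<in> carrier G. inv x \<in> A}"
  have "continuous_map (prod_topology T T) T (\<lambda>(p, x). x \<otimes> p)"
    unfolding case_prod_unfold by (intro continuous_map_mult continuous_map_fst continuous_map_snd)
  then have "openin T A"
    unfolding A_def by (rule openin_forall_compact[OF P PQ(1)])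
  then have "openin T V"
    unfolding V_def by (intro openin_Int openin_preimage continuous_inv)
  moreover have "subgroup V G"
  proof (rule subgroupI)
    show "V \<noteq> {}"
      using PG by (auto simp: V_def A_def subset_iff intro!: exI[of _ \<one>])
    fix x y assume "x \<in> V" "y \<in> V"
    then show "x \<otimes> y \<in> V"
      using PG by (auto simp: V_def A_def subset_iff m_assoc inv_mult_group)
  qed (auto simp: V_def A_def)
  ultimately have V: "OS V"
    by (simp add: open_subgroup_def)
  have VP: "V \<subseteq> P"
    using PQ(5) by (auto simp: V_def A_def dest!: bspec[of P _ \<one>])
  then show ?thesis
    using V PQ(6) closed_compactin[OF P VP OS_closedin[OF V]] by blast
qed

end

section \<open>Consequences of simplicity and compact generation\<close>

locale simple_tdlc = tdlc +
  assumes nondiscrete: "T \<noteq> discrete_topology (carrier G)"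
    and compactly_gen: "compactly_generated G T"
    and simple: "topologically_simple G T"
begin

lemma exists_compact_open: "\<exists>U. OS U \<and> compactin T U"
  using van_Dantzig[of "carrier G"] OS_openin[OF OS_carrier] by auto

text \<open>The intersection of all conjugates of \<open>H\<close> is a closed normal subgroup
  containing \<open>x\<close>, so simplicity makes it all of \<open>G\<close>.\<close>

lemma closed_conjugation_invariant:
  assumes H: "subgroup H G" "closedin T H"
    and x: "x \<in> carrier G" "x \<noteq> \<one>" "\<And>g. g \<in> carrier G \<Longrightarrow> cj g x \<in> H"
  shows "H = carrier G"
proof -
  let ?N = "core_in (carrier G) H"
  have "?N = (\<Inter>g\<in>carrier G. {x \<in> carrier G. cj g x \<in> H})"
    using one_closed by (auto simp: core_in_def simp del: one_closed)
  moreover have "closedin T (\<Inter>g\<in>carrier G. {x \<in> carrier G. cj g x \<in> H})"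
    using H(2) by (intro closedin_INT closedin_preimage continuous_map_cj_left) auto
  ultimately have "closedin T ?N"
    by simp
  moreover have "?N \<lhd> G"
    using subgroup_core_in[OF _ H(1)] cj_core_in[OF subgroup_self] by (simp add: normal_inv_iff cj_def)
  moreover have "?N \<noteq> {\<one>}"
    using x by (auto simp: core_in_def)
  ultimately have "?N = carrier G"
    using simple unfolding topologically_simple_def by blast
  then show ?thesis
    using core_in_subset[of "carrier G" H] subgroup.subset[OF H(1)] by auto
qed

lemma OS_nontrivial:
  assumes "OS V"
  shows "V \<noteq> {\<one>}"
proof
  assume V: "V = {\<one>}"
  have "openin T {x}" if "x \<in> carrier G" for x
    using openin_left_translate[OF OS_openin[OF assms] that] that V by simp
  then have "discrete_topology (carrier G) = T"
    by (simp add: discrete_topology_unique topspace_eq_carrier)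
  then show False using nondiscrete by simp
qed

text \<open>If \<open>G\<close> were compact, an open subgroup \<open>V\<close> missing some
  \<open>y\<close> would have an open, hence non-trivial, normal core, and simplicity would give
  \<open>V = carrier G\<close>.\<close>

lemma compact_OS_proper:
  assumes "OS U" "compactin T U"
  shows "U \<noteq> carrier G"
proof
  assume U: "U = carrier G"
  obtain y where y: "y \<in> carrier G" "y \<noteq> \<one>"
    using simple unfolding topologically_simple_def by blast
  have "closedin T {y}"
    using y Hausdorff by (simp add: closedin_Hausdorff_singleton topspace_eq_carrier)
  then have "openin T (carrier G - {y})"
    by (metis closedin_def topspace_eq_carrier)
  then obtain V where V: "OS V" "V \<subseteq> carrier G - {y}"
    using van_Dantzig[of "carrier G - {y}"] y by auto
  have N: "OS (core_in U V)"
    by (rule OS_core_in[OF assms(2) V(1)])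
  obtain x where x: "x \<in> core_in U V" "x \<noteq> \<one>"
    using OS_nontrivial[OF N] subgroup_eq_trivial_iff[OF OS_subgroup[OF N]] by blast
  have "V = carrier G"
    using closed_conjugation_invariant[OF OS_subgroup[OF V(1)] OS_closedin[OF V(1)], of x] x U
    by (auto simp: core_in_def)
  then show False using V(2) y by blast
qed

text \<open>\<open>U\<close> and all of \<open>X\<close> generate an open, hence closed, subgroup
  containing the conjugates of \<open>x\<close>, so it is \<open>G\<close>. It is the directed union
  of the open subgroups generated by \<open>U\<close> and finite parts of \<open>X\<close>; finitely
  many of these cover a compact generating set.\<close>

lemma generated_by_finite_conjugates:
  assumes U: "OS U" and X: "X \<subseteq> carrier G" "\<And>g x. g \<in> carrier G \<Longrightarrow> x \<in> X \<Longrightarrow> cj g x \<in> X"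
    and x: "x \<in> X" "x \<noteq> \<one>"
  shows "\<exists>F. finite F \<and> F \<subseteq> X \<and> generate G (U \<union> F) = carrier G"
proof -
  have sub: "U \<union> F \<subseteq> carrier G" if "F \<subseteq> X" for F
    using that X OS_subset[OF U] by blast
  have gen: "OS (generate G (U \<union> F))" if "F \<subseteq> X" for F
    by (rule OS_supergroup[OF U _ generate_is_subgroup[OF sub[OF that]]]) (auto intro: generate.incl)
  have genX: "generate G (U \<union> X) = carrier G"
  proof (rule closed_conjugation_invariant)
    show "subgroup (generate G (U \<union> X)) G" "closedin T (generate G (U \<union> X))"
      using gen[OF subset_refl] by (rule OS_subgroup, rule OS_closedin)
    show "x \<in> carrier G" using x(1) X(1) by (rule rev_subsetD)
    show "cj g x \<in> generate G (U \<union> X)" if "g \<in> carrier G" for g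
      using X(2)[OF that x(1)] by (simp add: generate.incl)
  qed (rule x(2))
  have mono: "generate G (U \<union> F) \<subseteq> generate G (U \<union> F')" if "F \<subseteq> F'" for F F'
    using that by (intro mono_generate) auto
  have fin: "\<exists>F. finite F \<and> F \<subseteq> X \<and> y \<in> generate G (U \<union> F)" if "y \<in> generate G (U \<union> X)" for y
    using that
  proof (induction y rule: generate.induct)
    case one
    then show ?case by (intro exI[of _ "{}"]) (auto intro: generate.one)
  next
    case (incl h)
    \<comment> \<open>\<open>{h} \<inter> X\<close> is \<open>{h}\<close> or empty, so one witness
      serves for \<open>h \<in> X\<close> and for \<open>h \<in> U\<close>.\<close>
    then show ?case by (intro exI[of _ "{h} \<inter> X"]) (auto intro: generate.incl)
  next
    case (inv h)
    then show ?case by (intro exI[of _ "{h} \<inter> X"]) (auto intro: generate.inv)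
  next
    case (eng h1 h2)
    then obtain F1 F2 where F: "finite F1" "F1 \<subseteq> X" "h1 \<in> generate G (U \<union> F1)"
      "finite F2" "F2 \<subseteq> X" "h2 \<in> generate G (U \<union> F2)" by blast
    then have "h1 \<otimes> h2 \<in> generate G (U \<union> (F1 \<union> F2))"
      using mono[of F1 "F1 \<union> F2"] mono[of F2 "F1 \<union> F2"] by (intro generate.eng) auto
    then show ?case using F by (intro exI[of _ "F1 \<union> F2"]) auto
  qed
  obtain K where K: "compactin T K" "generate G K = carrier G"
    using compactly_gen unfolding compactly_generated_def by blast
  let ?I = "{F. finite F \<and> F \<subseteq> X}"
  have "K \<subseteq> (\<Union>F\<in>?I. generate G (U \<union> F))"
  proof
    fix y assume "y \<in> K"
    then have "y \<in> generate G (U \<union> X)"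
      using compactin_subset_topspace[OF K(1)] by (auto simp: genX topspace_eq_carrier)
    from fin[OF this] show "y \<in> (\<Union>F\<in>?I. generate G (U \<union> F))" by auto
  qed
  moreover have "openin T (generate G (U \<union> F))" if "F \<in> ?I" for F
    using that gen by (auto intro: OS_openin)
  ultimately obtain \<F> where \<F>: "finite \<F>" "\<F> \<subseteq> ?I" "K \<subseteq> (\<Union>F\<in>\<F>. generate G (U \<union> F))"
    using compactin_finite_subcover[OF K(1), of ?I "\<lambda>F. generate G (U \<union> F)"] by auto
  have F: "finite (\<Union>\<F>)" "\<Union>\<F> \<subseteq> X"
    using \<F> by auto
  have "K \<subseteq> generate G (U \<union> \<Union>\<F>)"
    using \<F>(3) mono[of _ "\<Union>\<F>"] by (auto dest!: subsetD)
  then have "carrier G \<subseteq> generate G (U \<union> \<Union>\<F>)"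
    using generate_subgroup_incl[OF _ generate_is_subgroup[OF sub[OF F(2)]], of K] K(2) by simp
  then show ?thesis
    using F generate_in_carrier[OF sub[OF F(2)]] by (intro exI[of _ "\<Union>\<F>"]) auto
qed

text \<open>The elements centralising an open part of \<open>B\<close> form a conjugation-invariant set. If it is
  non-trivial, finitely many of them generate \<open>G\<close> together with \<open>U\<close>, and then \<open>G\<close> normalises a
  non-trivial subgroup of \<open>B \<inter> V \<subseteq> U\<close>, which is impossible.\<close>

lemma commensurated_centralizer_trivial:
  assumes U: "OS U" "compactin T U"
    and B: "subgroup B G" "B \<subseteq> U" "\<And>u x. u \<in> U \<Longrightarrow> x \<in> B \<Longrightarrow> cj u x \<in> B"
    and nondisc: "\<And>V. OS V \<Longrightarrow> B \<inter> V \<noteq> {\<one>}"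
    and comm: "\<And>g. g \<in> carrier G \<Longrightarrow> \<exists>V. OS V \<and> (\<forall>x\<in>B \<inter> V. cj g x \<in> B)"
    and d: "d \<in> carrier G" "OS V0" "\<And>x. x \<in> B \<inter> V0 \<Longrightarrow> cj d x = x"
  shows "d = \<one>"
proof (rule ccontr)
  assume "d \<noteq> \<one>"
  have UG: "U \<subseteq> carrier G" by (rule OS_subset[OF U(1)])
  have BG: "B \<subseteq> carrier G" by (rule subgroup.subset[OF B(1)])
  define Q where "Q = {d \<in> carrier G. \<exists>V. OS V \<and> (\<forall>x\<in>B \<inter> V. cj d x = x)}"
  have Q: "cj g q \<in> Q" if g: "g \<in> carrier G" and q: "q \<in> Q" for g q
  proof -
    obtain V where V: "OS V" "\<forall>x\<in>B \<inter> V. cj q x = x"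
      using q unfolding Q_def by auto
    \<comment> \<open>Commensuration by \<open>inv g\<close> brings a small \<open>x \<in> B\<close>
      back into \<open>B\<close>; there \<open>q\<close> fixes it, so \<open>cj g q\<close> fixes
      \<open>x\<close>.\<close>
    obtain V' where V': "OS V'" "\<forall>x\<in>B \<inter> V'. cj (inv g) x \<in> B"
      using comm[of "inv g"] g by auto
    have "cj (cj g q) x = x" if x: "x \<in> B \<inter> (V' \<inter> cj g ` V)" for x
    proof -
      have xG: "x \<in> carrier G" using x BG by blast
      have "cj (inv g) x \<in> B \<inter> V"
        using x V' g xG by (auto simp: mem_cj_image[OF OS_subset[OF V(1)]])
      then have "cj q (cj (inv g) x) = cj (inv g) x"
        using V(2) by blast
      moreover have "cj (cj g q) x = cj g (cj q (cj (inv g) x))"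
        using g q xG by (simp add: Q_def cj_def m_assoc inv_mult_group)
      ultimately show ?thesis using g xG by simp
    qed
    moreover have "OS (V' \<inter> cj g ` V)"
      using V V' g by (intro OS_Int OS_cj_image)
    moreover have "cj g q \<in> carrier G"
      using g q by (simp add: Q_def)
    ultimately show ?thesis
      unfolding Q_def by (auto intro!: exI[of _ "V' \<inter> cj g ` V"])
  qed
  have QG: "Q \<subseteq> carrier G" by (auto simp: Q_def)
  have dQ: "d \<in> Q" unfolding Q_def using d by auto
  have "\<exists>F. finite F \<and> F \<subseteq> Q \<and> generate G (U \<union> F) = carrier G"
    by (rule generated_by_finite_conjugates[OF U(1) QG _ dQ \<open>d \<noteq> \<one>\<close>]) (rule Q)
  then obtain F where F: "finite F" "F \<subseteq> Q" "generate G (U \<union> F) = carrier G"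
    by (elim exE conjE)
  obtain W where W: "\<And>f. f \<in> F \<Longrightarrow> OS (W f) \<and> (\<forall>x\<in>B \<inter> W f. cj f x = x)"
    using F(2) unfolding Q_def by (simp add: subset_iff) metis
  obtain V where V: "OS V" "\<forall>f\<in>F. V \<subseteq> W f"
    using OS_finite_INT[OF F(1), of W] W by auto
  \<comment> \<open>Thanks to the core, \<open>B \<inter> V'\<close> is normalised by
    \<open>U\<close>; it is fixed pointwise by \<open>F\<close>, so all of \<open>G\<close>
    normalises it, and its elements have all their conjugates in \<open>U\<close>.\<close>
  define V' where "V' = core_in U V"
  have V': "OS V'" "V' \<subseteq> V"
    using OS_core_in[OF U(2) V(1)] core_in_subset[of U V] subgroup.one_closed[OF OS_subgroup[OF U(1)]]
    by (simp_all add: V'_def)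
  have FG: "U \<union> F \<subseteq> carrier G" using F(2) UG unfolding Q_def by blast
  have Uinv: "cj u x \<in> B \<inter> V'" if "u \<in> U" "x \<in> B \<inter> V'" for u x
    using that B(3) cj_core_in[OF OS_subgroup[OF U(1)]] by (auto simp: V'_def)
  have Ffix: "cj f x = x" if "f \<in> F" "x \<in> B \<inter> V'" for f x
    using that W[OF that(1)] V(2) V'(2) by (auto dest!: subsetD)
  have Finv: "cj (inv f) x = x" if "f \<in> F" "x \<in> B \<inter> V'" for f x
    using cj_inv_cancel(2)[of f x] Ffix[OF that] that FG BG by auto
  have "cj g x \<in> B \<inter> V'" if "g \<in> carrier G" "x \<in> B \<inter> V'" for g x
  proof (rule generate_cj_invariant[OF FG _ _ _ _ that(2)])
    show "g \<in> generate G (U \<union> F)" using that F(3) by simp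
    fix y s assume y: "y \<in> U \<union> F" and s: "s \<in> B \<inter> V'"
    show "cj y s \<in> B \<inter> V'" using y s Uinv Ffix by auto
    show "cj (inv y) s \<in> B \<inter> V'"
      using y s Uinv[of "inv y"] Finv subgroup.m_inv_closed[OF OS_subgroup[OF U(1)]] by auto
  qed (use BG in blast)
  moreover obtain x where "x \<in> B \<inter> V'" "x \<noteq> \<one>"
    using nondisc[OF V'(1)] subgroup_eq_trivial_iff[OF subgroup_Int[OF B(1) OS_subgroup[OF V'(1)]]] by blast
  ultimately have "U = carrier G"
    using closed_conjugation_invariant[OF OS_subgroup[OF U(1)] OS_closedin[OF U(1)], of x] B(2) BG by blast
  then show False using compact_OS_proper[OF U] by blast
qed

text \<open>In the usual terminology: the quasi-centre of \<open>G\<close> is trivial.\<close>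

lemma open_centralizer_trivial:
  assumes "d \<in> carrier G" "OS V" "\<And>x. x \<in> V \<Longrightarrow> cj d x = x"
  shows "d = \<one>"
proof -
  obtain U where U: "OS U" "compactin T U" using exists_compact_open by blast
  show ?thesis
  proof (rule commensurated_centralizer_trivial[OF U OS_subgroup[OF U(1)] subset_refl _ _ _ assms(1,2)])
    show "cj u x \<in> U" if "u \<in> U" "x \<in> U" for u x
      using that cj_subgroup_closed[OF OS_subgroup[OF U(1)]] by blast
    show "U \<inter> V \<noteq> {\<one>}" if "OS V" for V
      using OS_nontrivial[OF OS_Int[OF U(1) that]] .
    show "\<exists>V. OS V \<and> (\<forall>x\<in>U \<inter> V. cj g x \<in> U)" if "g \<in> carrier G" for g
      using that OS_cj_image[OF U(1), of "inv g"] OS_subset[OF U(1)]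
      by (intro exI[of _ "cj (inv g) ` U"]) (auto simp: subset_iff)
  qed (use assms in auto)
qed

end

section \<open>Locally normal subgroups\<close>

context topological_group
begin

text \<open>An open subgroup inside the normaliser already makes the normaliser open. Closedness is
  a separate condition, see \<open>closed_locally_normal_iff\<close>.\<close>

definition locally_normal :: "'a set \<Rightarrow> bool" where
  "locally_normal H \<longleftrightarrow> subgroup H G \<and> (\<exists>V. OS V \<and> (\<forall>v\<in>V. \<forall>h\<in>H. cj v h \<in> H))"

lemma ln_subgroup: "locally_normal H \<Longrightarrow> subgroup H G"
  by (simp add: locally_normal_def)

lemma ln_subset: "locally_normal H \<Longrightarrow> H \<subseteq> carrier G"
  by (simp add: ln_subgroup subgroup.subset)

lemma ln_OS: "OS V \<Longrightarrow> locally_normal V"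
  unfolding locally_normal_def using OS_subgroup cj_subgroup_closed by blast

lemma ln_Int:
  assumes "locally_normal H" "locally_normal K"
  shows "locally_normal (H \<inter> K)"
proof -
  obtain V W where "OS V" "\<forall>v\<in>V. \<forall>h\<in>H. cj v h \<in> H" "OS W" "\<forall>v\<in>W. \<forall>h\<in>K. cj v h \<in> K"
    using assms unfolding locally_normal_def by auto
  then show ?thesis
    using assms unfolding locally_normal_def
    by (auto intro!: subgroup_Int OS_Int exI[of _ "V \<inter> W"])
qed

lemma ln_centralizer:
  assumes "locally_normal H"
  shows "locally_normal (centralizer G H)"
proof -
  have HG: "H \<subseteq> carrier G" by (rule ln_subset[OF assms])
  obtain V where V: "OS V" "\<forall>v\<in>V. \<forall>h\<in>H. cj v h \<in> H"
    using assms unfolding locally_normal_def by auto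
  have "cj v c \<in> centralizer G H" if v: "v \<in> V" and c: "c \<in> centralizer G H" for v c
  proof -
    have G: "v \<in> carrier G" "c \<in> carrier G"
      using v c OS_subset[OF V(1)] centralizer_subset by auto
    have "cj (cj v c) h = h" if h: "h \<in> H" for h
    proof -
      have "cj (inv v) h \<in> H"
        using V(2) subgroup.m_inv_closed[OF OS_subgroup[OF V(1)] v] h by blast
      then have "cj c (cj (inv v) h) = cj (inv v) h"
        using c by (simp add: mem_centralizer_iff[OF HG])
      then show ?thesis using G h HG by (auto simp: cj_by_cj)
    qed
    then show ?thesis
      using G by (simp add: mem_centralizer_iff[OF HG])
  qed
  then show ?thesis
    using V(1) subgroup_centralizer[OF HG] unfolding locally_normal_def by auto
qed

lemma ln_cj_image:
  assumes "locally_normal H" "g \<in> carrier G"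
  shows "locally_normal (cj g ` H)"
proof -
  obtain V where V: "OS V" "\<forall>v\<in>V. \<forall>h\<in>H. cj v h \<in> H"
    using assms unfolding locally_normal_def by auto
  have "cj v h \<in> cj g ` H" if v: "v \<in> cj g ` V" and h: "h \<in> cj g ` H" for v h
  proof -
    obtain v' h' where *: "v = cj g v'" "v' \<in> V" "h = cj g h'" "h' \<in> H"
      using v h by blast
    then have "cj v h = cj g (cj v' h')"
      using assms(2) OS_subset[OF V(1)] ln_subset[OF assms(1)] by (simp add: cj_cj_swap[symmetric] subset_iff)
    then show ?thesis using * V(2) by simp
  qed
  then show ?thesis
    using assms OS_cj_image[OF V(1) assms(2)] unfolding locally_normal_def
    by (auto intro!: subgroup_cj_image exI[of _ "cj g ` V"])
qed

lemma ln_normalized: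
  assumes "OS V" "\<forall>v\<in>V. \<forall>h\<in>H. cj v h \<in> H" "H \<subseteq> carrier G" "v \<in> V"
  shows "cj v ` H = H"
proof -
  have v: "v \<in> carrier G" "inv v \<in> V"
    using assms(4) OS_subset[OF assms(1)] subgroup.m_inv_closed[OF OS_subgroup[OF assms(1)]] by auto
  have "h \<in> cj v ` H" if "h \<in> H" for h
    using v assms(2,3) that by (subst mem_cj_image) auto
  then show ?thesis using assms by auto
qed

text \<open>The normaliser, seen as a point stabiliser of the conjugation action on
  subgroups.\<close>

definition stab :: "'a set \<Rightarrow> 'a set" where
  "stab H = {g \<in> carrier G. cj g ` H = H}"

lemma subgroup_stab:
  assumes "H \<subseteq> carrier G"
  shows "subgroup (stab H) G"
proof (rule subgroupI)
  show "stab H \<noteq> {}"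
    using assms by (auto simp: stab_def intro!: exI[of _ \<one>])
  fix g assume g: "g \<in> stab H"
  then show "inv g \<in> stab H"
    using cj_image_inv_cancel(2)[OF assms, of g] by (simp add: stab_def)
  fix h assume "h \<in> stab H"
  with g show "g \<otimes> h \<in> stab H"
    using assms by (simp add: stab_def cj_image_cj_image[symmetric])
qed (auto simp: stab_def)

lemma OS_stab:
  assumes "locally_normal H"
  shows "OS (stab H)"
proof -
  obtain V where V: "OS V" "\<forall>v\<in>V. \<forall>h\<in>H. cj v h \<in> H"
    using assms unfolding locally_normal_def by auto
  have "V \<subseteq> stab H"
    using ln_normalized[OF V ln_subset[OF assms]] OS_subset[OF V(1)] by (auto simp: stab_def)
  then show ?thesis
    by (rule OS_supergroup[OF V(1) _ subgroup_stab[OF ln_subset[OF assms]]])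
qed

lemma centralizer_cj_image_eq:
  "locally_normal H \<Longrightarrow> g \<in> carrier G \<Longrightarrow> centralizer G (cj g ` H) = cj g ` centralizer G H"
  by (simp add: centralizer_cj_image ln_subset)

text \<open>The regular subgroups represent the elements of \<open>\<L>\<C>(G)\<close>: meets are intersections and
  complements are centralisers.\<close>

definition regular :: "'a set \<Rightarrow> bool" where
  "regular H \<longleftrightarrow> locally_normal H \<and> centralizer G (centralizer G H) = H"

lemma regular_ln: "regular H \<Longrightarrow> locally_normal H"
  by (simp add: regular_def)

lemma regular_subset: "regular H \<Longrightarrow> H \<subseteq> carrier G"
  by (simp add: regular_def ln_subset)

lemma regular_centralizer: "locally_normal H \<Longrightarrow> regular (centralizer G H)"
  by (simp add: regular_def ln_centralizer triple_centralizer ln_subset)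

lemma regular_Int:
  assumes "regular H" "regular K"
  shows "regular (H \<inter> K)"
proof -
  have "centralizer G (centralizer G (H \<inter> K)) \<subseteq> centralizer G (centralizer G H)"
    "centralizer G (centralizer G (H \<inter> K)) \<subseteq> centralizer G (centralizer G K)"
    by (intro centralizer_antimono; simp)+
  moreover have "H \<inter> K \<subseteq> centralizer G (centralizer G (H \<inter> K))"
    using regular_subset[OF assms(1)] by (intro subset_double_centralizer) auto
  ultimately show ?thesis
    using assms by (auto simp: regular_def intro: ln_Int)
qed

lemma regular_cj_image: "regular H \<Longrightarrow> g \<in> carrier G \<Longrightarrow> regular (cj g ` H)"
  by (simp add: regular_def ln_cj_image centralizer_cj_image_eq ln_centralizer)

section \<open>Comparison with the classes of the structure lattice\<close>

lemma normalizer_eq_stab: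
  assumes "H \<subseteq> carrier G"
  shows "normalizer G H = stab H"
proof -
  have "g <# H #> inv g = cj g ` H" for g
    by (auto simp: l_coset_def r_coset_def cj_def)
  then show ?thesis
    using assms by (auto simp: normalizer_def stabilizer_def stab_def)
qed

lemma closed_locally_normal_iff:
  "H \<in> closed_locally_normal G T \<longleftrightarrow> locally_normal H \<and> closedin T H"
proof -
  have "openin T (stab H) \<longleftrightarrow> locally_normal H" if H: "subgroup H G"
  proof
    assume "openin T (stab H)"
    then have "OS (stab H)"
      using subgroup_stab[OF subgroup.subset[OF H]] by (simp add: open_subgroup_def)
    moreover have "\<forall>v\<in>stab H. \<forall>h\<in>H. cj v h \<in> H" by (auto simp: stab_def)
    ultimately show "locally_normal H" using H unfolding locally_normal_def by blast
  qed (rule OS_openin[OF OS_stab])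
  then show ?thesis
    using normalizer_eq_stab[OF subgroup.subset] ln_subgroup
    by (auto simp: closed_locally_normal_def)
qed

text \<open>If \<open>K\<close> is commensurate with \<open>V\<close>, it contains the open subgroup
  \<open>V \<inter> K\<close>. The right side does not depend on \<open>V\<close>, so all open
  subgroups share one class.\<close>

lemma lattice_class_OS:
  assumes "OS V"
  shows "lattice_class G T V = {K \<in> closed_locally_normal G T. openin T K}"
proof -
  have V: "V \<in> closed_locally_normal G T"
    using assms by (simp add: closed_locally_normal_iff ln_OS OS_closedin)
  have "openin (subtopology T V) (V \<inter> K) \<and> openin (subtopology T K) (V \<inter> K) \<longleftrightarrow> openin T K"
    if K: "K \<in> closed_locally_normal G T" for K
  proof
    have Ksub: "subgroup K G" using K by (simp add: closed_locally_normal_def)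
    assume "openin (subtopology T V) (V \<inter> K) \<and> openin (subtopology T K) (V \<inter> K)"
    then have "openin T (V \<inter> K)"
      using openin_open_subtopology[OF OS_openin[OF assms]] by blast
    then have "OS (V \<inter> K)"
      using subgroup_Int[OF OS_subgroup[OF assms] Ksub] by (simp add: open_subgroup_def)
    then show "openin T K" using OS_openin[OF OS_supergroup[OF _ Int_lower2 Ksub]] by blast
  next
    assume "openin T K"
    then show "openin (subtopology T V) (V \<inter> K) \<and> openin (subtopology T K) (V \<inter> K)"
      using OS_openin[OF assms] by (simp add: openin_open_subtopology openin_Int)
  qed
  then show ?thesis using V by (auto simp: lattice_class_def commensurate_def)
qed

end

section \<open>Discrete and abelian locally normal subgroups\<close>

context simple_tdlc
begin

text \<open>For \<open>v\<close> close to \<open>\<one>\<close> the commutator of \<open>v\<close>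
  and \<open>h\<close> is in \<open>V\<close> by continuity and in \<open>H\<close> by local
  normality, hence trivial. So \<open>h\<close> centralises an open subgroup, and
  \<open>open_centralizer_trivial\<close> applies.\<close>

lemma ln_trivial_if_discrete:
  assumes H: "locally_normal H" and V: "OS V" "H \<inter> V = {\<one>}"
  shows "H = {\<one>}"
proof -
  have HG: "H \<subseteq> carrier G" by (rule ln_subset[OF H])
  obtain V0 where V0: "OS V0" "\<forall>v\<in>V0. \<forall>h\<in>H. cj v h \<in> H"
    using H unfolding locally_normal_def by auto
  have "h = \<one>" if h: "h \<in> H" for h
  proof -
    have hG: "h \<in> carrier G" using h HG by auto
    let ?N = "{v \<in> carrier G. cj v h \<otimes> inv h \<in> V}"
    have "openin T (?N \<inter> V0)"
      using hG continuous_map_id[of T] OS_openin[OF V(1)] OS_openin[OF V0(1)]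
      by (intro openin_Int openin_preimage continuous_map_mult continuous_map_cj continuous_map_group_const)
         (auto simp: id_def)
    then obtain V1 where V1: "OS V1" "V1 \<subseteq> ?N \<inter> V0"
      using van_Dantzig[of "?N \<inter> V0"] hG subgroup.one_closed[OF OS_subgroup] V(1) V0(1) by auto
    have "cj h v = v" if v: "v \<in> V1" for v
    proof -
      have vG: "v \<in> carrier G" using v V1 by auto
      have "cj v h \<otimes> inv h \<in> V" using v V1(2) by auto
      moreover have "cj v h \<otimes> inv h \<in> H"
        using v V1(2) V0(2) h ln_subgroup[OF H] by (auto intro: subgroup.m_closed subgroup.m_inv_closed)
      ultimately have "cj v h \<otimes> inv h = \<one>" using V(2) by auto
      then show ?thesis
        using vG hG by (simp add: commutator_eq_one_iff cj_eq_sym)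
    qed
    then show ?thesis by (rule open_centralizer_trivial[OF hG V1(1)])
  qed
  then show ?thesis using subgroup_eq_trivial_iff[OF ln_subgroup[OF H]] by simp
qed

text \<open>Finitely many conjugates of an abelian locally normal subgroup together with a compact open
  subgroup generate \<open>G\<close>; the subgroup they generate inside a small enough open subgroup
  is commensurated by \<open>G\<close>, yet it is centralised by a non-trivial element.\<close>

lemma abelian_locally_normal_trivial:
  assumes A: "locally_normal A" and ab: "\<And>x y. x \<in> A \<Longrightarrow> y \<in> A \<Longrightarrow> cj x y = y"
  shows "A = {\<one>}"
proof (rule ccontr)
  assume A1: "A \<noteq> {\<one>}"
  then obtain a where a: "a \<in> A" "a \<noteq> \<one>"
    using subgroup_eq_trivial_iff[OF ln_subgroup[OF A]] by auto
  have AG: "A \<subseteq> carrier G" by (rule ln_subset[OF A])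
  obtain U where U: "OS U" "compactin T U" using exists_compact_open by auto
  have Usub: "subgroup U G" and UG: "U \<subseteq> carrier G" and U1: "\<one> \<in> U"
    using OS_subgroup[OF U(1)] OS_subset[OF U(1)] subgroup.one_closed by auto
  define X where "X = (\<Union>g\<in>carrier G. cj g ` A)"
  have "\<exists>F. finite F \<and> F \<subseteq> X \<and> generate G (U \<union> F) = carrier G"
  proof (rule generated_by_finite_conjugates[OF U(1)])
    show "X \<subseteq> carrier G" using AG by (auto simp: X_def)
    show "cj g x \<in> X" if "g \<in> carrier G" "x \<in> X" for g x
    proof -
      obtain h y where h: "h \<in> carrier G" "y \<in> A" "x = cj h y"
        using \<open>x \<in> X\<close> by (auto simp: X_def)
      then have "cj g x = cj (g \<otimes> h) y"
        using that(1) AG by (simp add: cj_cj subset_iff)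
      then show ?thesis
        using that(1) h unfolding X_def by blast
    qed
    show "a \<in> X"
      using a AG by (auto simp: X_def intro!: bexI[of _ \<one>] image_eqI[of _ _ a])
  qed (rule a(2))
  then obtain F where F: "finite F" "F \<subseteq> X" "generate G (U \<union> F) = carrier G"
    by (elim exE conjE)
  have "\<forall>f\<in>F. \<exists>g. g \<in> carrier G \<and> f \<in> cj g ` A"
    using F(2) unfolding X_def by blast
  then obtain \<gamma> where \<gamma>: "\<And>f. f \<in> F \<Longrightarrow> \<gamma> f \<in> carrier G \<and> f \<in> cj (\<gamma> f) ` A"
    by metis
  define A' where "A' f = cj (\<gamma> f) ` A" for f
  have A': "locally_normal (A' f)" "A' f \<noteq> {\<one>}" "f \<in> A' f" if "f \<in> F" for f
    using \<gamma>[OF that] A A1 AG unfolding A'_def by (auto intro: ln_cj_image)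
  have A'ab: "cj x y = y" if "f \<in> F" "x \<in> A' f" "y \<in> A' f" for f x y
    using that \<gamma>[OF that(1)] ab AG by (auto simp: A'_def cj_cj_swap[symmetric] subset_iff)
  have A'G: "A' f \<subseteq> carrier G" if "f \<in> F" for f using A'[OF that] ln_subset by auto
  obtain Vf where Vf: "\<And>f. f \<in> F \<Longrightarrow> OS (Vf f) \<and> (\<forall>v\<in>Vf f. \<forall>h\<in>A' f. cj v h \<in> A' f)"
    using A'(1) unfolding locally_normal_def by metis
  obtain V where V: "OS V" "\<forall>f\<in>F. V \<subseteq> Vf f"
    using OS_finite_INT[OF F(1), of Vf] Vf by auto
  have Vnorm: "cj v x \<in> A' f" if "f \<in> F" "v \<in> V" "x \<in> A' f" for f v x
    using that V(2) Vf[OF that(1)] by auto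
  \<comment> \<open>\<open>W\<close> normalises every \<open>A' f\<close> because it lies in
    \<open>V\<close>, and as a core it is itself normalised by \<open>U\<close>.\<close>
  define W where "W = core_in U (V \<inter> U)"
  have W: "OS W" "W \<subseteq> V" "W \<subseteq> U"
    using OS_core_in[OF U(2) OS_Int[OF V(1) U(1)]] core_in_subset[OF U1, of "V \<inter> U"] by (auto simp: W_def)
  have WU: "cj u w \<in> W" if "u \<in> U" "w \<in> W" for u w
    using cj_core_in[OF Usub] that by (simp add: W_def)
  have Wsub: "subgroup W G" and WG: "W \<subseteq> carrier G"
    using OS_subgroup[OF W(1)] OS_subset[OF W(1)] by auto
  \<comment> \<open>The building blocks of \<open>B\<close>: abelian subgroups of \<open>W\<close>,
    normal in \<open>W\<close>, and permuted by conjugation with \<open>U\<close>.\<close>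
  define N where "N = (\<lambda>(u, f). cj u ` A' f \<inter> W)"
  have Nsub: "subgroup (N (u, f)) G" "N (u, f) \<subseteq> W" if "u \<in> U" "f \<in> F" for u f
    using that UG ln_subgroup[OF A'(1)[OF that(2)]] Wsub
    by (auto simp: N_def intro!: subgroup_Int subgroup_cj_image)
  have Ncj: "cj w x \<in> N (u, f)" if that: "u \<in> U" "f \<in> F" "w \<in> W" "x \<in> N (u, f)" for u f w x
  proof -
    have "\<exists>y. x = cj u y \<and> y \<in> A' f \<and> x \<in> W" using that(4) by (auto simp: N_def)
    then obtain y where y: "x = cj u y" "y \<in> A' f" "x \<in> W" by (elim exE conjE)
    have G: "u \<in> carrier G" "w \<in> carrier G" "y \<in> carrier G" "inv u \<in> U"
      using that y UG WG A'G[OF that(2)] subgroup.m_inv_closed[OF Usub] by auto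
    have "cj w x = cj u (cj (cj (inv u) w) y)"
      using G by (simp add: y cj_by_cj)
    moreover have "cj (cj (inv u) w) y \<in> A' f"
      using Vnorm[OF that(2) _ y(2)] WU[OF G(4) that(3)] W(2) by auto
    ultimately have "cj w x \<in> cj u ` A' f" by (rule image_eqI)
    then show ?thesis
      using cj_subgroup_closed[OF Wsub that(3) y(3)] by (simp add: N_def)
  qed
  have Nab: "cj x y = y" if "u \<in> U" "f \<in> F" "x \<in> N (u, f)" "y \<in> N (u, f)" for u f x y
    using that A'ab[OF that(2)] A'G[OF that(2)] UG by (auto simp: N_def cj_cj_swap[symmetric] subset_iff)
  have NU: "cj u' x \<in> N (u' \<otimes> u, f)" if "u \<in> U" "f \<in> F" "u' \<in> U" "x \<in> N (u, f)" for u u' f x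
    using that A'G[OF that(2)] UG WU[OF that(3)] by (auto simp: N_def cj_cj subset_iff)
  \<comment> \<open>\<open>N (u, f)\<close> depends only on \<open>f\<close> and the left coset of
    \<open>V\<close> containing \<open>u\<close>, as \<open>V\<close> normalises
    \<open>A' f\<close>; finitely many such cosets cover the compact \<open>U\<close>.\<close>
  have fin: "finite (N ` (U \<times> F))"
  proof -
    obtain E where E: "finite E" "E \<subseteq> U" "U \<subseteq> (\<Union>e\<in>E. (\<otimes>) e ` V)"
      using finite_cosets_compact[OF U(2) V(1)] by auto
    have "N (u, f) \<in> N ` (E \<times> F)" if u: "u \<in> U" and f: "f \<in> F" for u f
    proof -
      obtain e v where ev: "e \<in> E" "v \<in> V" "u = e \<otimes> v" using E(3) u by auto
      have "cj u ` A' f = cj e ` cj v ` A' f"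
        using ev E(2) UG OS_subset[OF V(1)] A'G[OF f] by (subst cj_image_cj_image) auto
      also have "cj v ` A' f = A' f"
        using ln_normalized[OF V(1) _ A'G[OF f] ev(2)] Vnorm[OF f] by auto
      finally show ?thesis using ev f by (auto simp: N_def)
    qed
    then have "N ` (U \<times> F) \<subseteq> N ` (E \<times> F)" by auto
    then show ?thesis using E(1) F(1) by (meson finite_SigmaI finite_imageI finite_subset)
  qed
  define S where "S = (\<Union>i\<in>U \<times> F. N i)"
  define B where "B = generate G S"
  have SW: "S \<subseteq> W" using Nsub(2) unfolding S_def by blast
  have SG: "S \<subseteq> carrier G" using SW WG by auto
  have Bsub: "subgroup B G" unfolding B_def by (rule generate_is_subgroup[OF SG])
  have BG: "B \<subseteq> carrier G" by (rule subgroup.subset[OF Bsub])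
  have BW: "B \<subseteq> W" unfolding B_def by (rule generate_subgroup_incl[OF SW Wsub])
  have NB: "x \<in> B" if "f \<in> F" "x \<in> A' f" "x \<in> W" for f x
  proof -
    have "x \<in> N (\<one>, f)"
      using that A'G[OF that(1)] by (simp add: N_def)
    then show ?thesis
      using that(1) U1 unfolding B_def S_def by (intro generate.incl) blast
  qed
  have BU: "cj u x \<in> B" if u: "u \<in> U" and x: "x \<in> B" for u x
  proof -
    have uG: "u \<in> carrier G" using u UG by auto
    have uS: "cj u h \<in> S" if h: "h \<in> S" for h
    proof -
      obtain u' f where "u' \<in> U" "f \<in> F" "h \<in> N (u', f)"
        using h by (auto simp: S_def)
      then show ?thesis
        using NU[OF _ _ u] subgroup.m_closed[OF Usub u] unfolding S_def by blast
    qed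
    from x show ?thesis unfolding B_def
    proof (induction x rule: generate.induct)
      case one
      then show ?case using uG by (simp add: generate.one)
    next
      case (incl h)
      then show ?case using uS by (intro generate.incl)
    next
      case (inv h)
      then have "inv (cj u h) \<in> generate G S" using uS by (intro generate.inv)
      then show ?case using inv uG SG by (simp add: cj_inv subset_iff)
    next
      case (eng h1 h2)
      then show ?case
        using uG BG by (simp add: B_def cj_mult subset_iff generate.eng)
    qed
  qed
  \<comment> \<open>If \<open>F\<close> were empty, the proper subgroup \<open>U\<close> would
    generate \<open>G\<close>; for \<open>f \<in> F\<close>, the part of \<open>A' f\<close> in
    \<open>W\<close> lies in \<open>B\<close> and is not discrete.\<close>
  have nondisc: "B \<inter> V' \<noteq> {\<one>}" if V': "OS V'" for V'
  proof -
    have "F \<noteq> {}"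
    proof
      assume "F = {}"
      then have "carrier G = generate G U" using F(3) by simp
      also have "\<dots> \<subseteq> U" by (rule generate_subgroup_incl[OF subset_refl Usub])
      finally show False using compact_OS_proper[OF U] UG by auto
    qed
    then obtain f where f: "f \<in> F" by auto
    have "A' f \<inter> (W \<inter> V') \<noteq> {\<one>}"
      using ln_trivial_if_discrete[OF A'(1)[OF f] OS_Int[OF W(1) V']] A'(2)[OF f] by blast
    moreover have "A' f \<inter> (W \<inter> V') \<subseteq> B \<inter> V'" using NB[OF f] by auto
    moreover have "\<one> \<in> A' f \<inter> (W \<inter> V')"
      using subgroup.one_closed ln_subgroup[OF A'(1)[OF f]] Wsub OS_subgroup[OF V'] by auto
    ultimately show ?thesis by auto
  qed
  \<comment> \<open>For \<open>x \<in> B\<close> close to \<open>\<one>\<close> the commutator of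
    \<open>f'\<close> and \<open>x\<close> lies in \<open>A' f\<close> and in \<open>W\<close>, so
    in \<open>B\<close> by \<open>NB\<close>; multiplying it by \<open>x\<close> gives
    \<open>cj f' x\<close>.\<close>
  have commA: "\<exists>V. OS V \<and> (\<forall>x\<in>B \<inter> V. cj f' x \<in> B)" if f: "f \<in> F" and f': "f' \<in> A' f" for f f'
  proof -
    have f'G: "f' \<in> carrier G" using f' A'G[OF f] by auto
    let ?N = "{x \<in> carrier G. f' \<otimes> cj x (inv f') \<in> W}"
    have "openin T ?N"
      using f'G continuous_map_id[of T] OS_openin[OF W(1)]
      by (intro openin_preimage continuous_map_mult continuous_map_cj continuous_map_group_const)
         (auto simp: id_def)
    then obtain V1 where V1: "OS V1" "V1 \<subseteq> ?N"
      using van_Dantzig[of ?N] f'G subgroup.one_closed[OF Wsub] by auto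
    have "cj f' x \<in> B" if x: "x \<in> B \<inter> V1" for x
    proof -
      have xG: "x \<in> carrier G" using x BG by auto
      have A'sub: "subgroup (A' f) G" by (rule ln_subgroup[OF A'(1)[OF f]])
      have "cj x (inv f') \<in> A' f"
        using Vnorm[OF f, of x] x BW W(2) f' A'sub by (auto intro: subgroup.m_inv_closed)
      then have "f' \<otimes> cj x (inv f') \<in> A' f"
        using f' A'sub by (auto intro: subgroup.m_closed)
      then have "cj f' x \<otimes> inv x \<in> B"
        using NB[OF f] x V1(2) f'G xG by (auto simp: commutator_alt)
      then have "cj f' x \<otimes> inv x \<otimes> x \<in> B"
        using x Bsub by (auto intro: subgroup.m_closed)
      then show ?thesis using f'G xG by (simp add: m_assoc)
    qed
    then show ?thesis using V1(1) by auto
  qed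
  have UF: "U \<union> F \<subseteq> carrier G" using UG A'(3) A'G by blast
  \<comment> \<open>Commensuration passes from \<open>U \<union> F\<close> to the generated group;
    the inverse of \<open>h \<in> F\<close> is covered by \<open>commA\<close> because it lies in
    \<open>A' h\<close>.\<close>
  have comm: "\<exists>V. OS V \<and> (\<forall>x\<in>B \<inter> V. cj g x \<in> B)" if "g \<in> carrier G" for g
    using that unfolding F(3)[symmetric]
  proof (induction g rule: generate.induct)
    case one
    then show ?case using OS_carrier BG by (auto intro!: exI[of _ "carrier G"])
  next
    case (incl h)
    then show ?case using commA A'(3) BU OS_carrier by (cases "h \<in> U") auto
  next
    case (inv h)
    show ?case
    proof (cases "h \<in> U")
      case True
      then show ?thesis
        using BU subgroup.m_inv_closed[OF Usub True] OS_carrier by auto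
    next
      case False
      then have h: "h \<in> F" using inv by auto
      show ?thesis
        using commA[OF h] subgroup.m_inv_closed[OF ln_subgroup[OF A'(1)[OF h]] A'(3)[OF h]] by auto
    qed
  next
    case (eng g h)
    then obtain Vg Vh where V: "OS Vg" "\<forall>x\<in>B \<inter> Vg. cj g x \<in> B" "OS Vh" "\<forall>x\<in>B \<inter> Vh. cj h x \<in> B"
      by auto
    have G: "g \<in> carrier G" "h \<in> carrier G"
      using eng F(3) by auto
    have "cj (g \<otimes> h) x \<in> B" if x: "x \<in> B \<inter> (Vh \<inter> cj (inv h) ` Vg)" for x
    proof -
      have xG: "x \<in> carrier G" using x BG by auto
      have "cj h x \<in> B \<inter> Vg"
        using x V(4) G xG mem_cj_image[OF OS_subset[OF V(1)], of "inv h" x] by auto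
      then show ?thesis using V(2) G xG by (simp add: cj_cj[symmetric])
    qed
    then show ?case
      using V G by (intro exI[of _ "Vh \<inter> cj (inv h) ` Vg"]) (auto intro: OS_Int OS_cj_image)
  qed
  \<comment> \<open>As there are finitely many blocks, some non-trivial \<open>D\<close> centralises
    all of them and hence \<open>B\<close>, contrary to
    \<open>commensurated_centralizer_trivial\<close>.\<close>
  have "\<exists>D. subgroup D G \<and> D \<subseteq> W \<and> D \<noteq> {\<one>} \<and> (\<forall>w\<in>W. \<forall>x\<in>D. cj w x \<in> D) \<and>
    (\<forall>M\<in>N ` (U \<times> F). \<forall>x\<in>M. \<forall>d\<in>D. cj d x = x)"
    by (rule common_centralizing_subgroup[OF Wsub OS_nontrivial[OF W(1)] fin])
       (use Nsub Ncj Nab in \<open>fastforce simp: subset_iff\<close>)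
  then obtain D where D: "subgroup D G" "D \<noteq> {\<one>}"
    "\<forall>M\<in>N ` (U \<times> F). \<forall>x\<in>M. \<forall>d\<in>D. cj d x = x"
    by (elim exE conjE)
  then obtain d where d: "d \<in> D" "d \<noteq> \<one>"
    using subgroup_eq_trivial_iff[OF D(1)] by auto
  have dG: "d \<in> carrier G" using d(1) subgroup.subset[OF D(1)] by auto
  have "S \<subseteq> centralizer G {d}"
    using D(3) d(1) SG dG by (auto simp: S_def mem_centralizer_iff cj_eq_sym[of _ d] subset_iff)
  then have "B \<subseteq> centralizer G {d}"
    unfolding B_def using dG by (intro generate_subgroup_incl subgroup_centralizer) auto
  then have "cj d x = x" if "x \<in> B" for x
    using that dG by (auto simp: mem_centralizer_iff cj_eq_sym[of d] subset_iff)
  then have "d = \<one>"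
    using W(3) BW
    by (intro commensurated_centralizer_trivial[OF U Bsub _ BU nondisc comm dG OS_carrier]) auto
  then show False using d(2) by simp
qed

text \<open>Inside \<open>V\<close>, the left side consists of elements of
  \<open>H \<inter> V\<close> that centralise \<open>H \<inter> V\<close>; this part is abelian,
  hence trivial, and \<open>ln_trivial_if_discrete\<close> applies.\<close>

lemma Int_centralizer_Int_OS_trivial:
  assumes H: "locally_normal H" and V: "OS V"
  shows "H \<inter> centralizer G (H \<inter> V) = {\<one>}"
proof -
  let ?P = "H \<inter> centralizer G (H \<inter> V)"
  have HV: "locally_normal (H \<inter> V)" by (intro ln_Int H ln_OS V)
  have P: "locally_normal ?P" by (intro ln_Int H ln_centralizer HV)
  have "?P \<inter> V = {\<one>}"
  proof (rule abelian_locally_normal_trivial)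
    show "locally_normal (?P \<inter> V)" by (intro ln_Int P ln_OS V)
    show "cj x y = y" if "x \<in> ?P \<inter> V" "y \<in> ?P \<inter> V" for x y
      using that mem_centralizer_iff[OF ln_subset[OF HV], of x] by auto
  qed
  then show ?thesis by (rule ln_trivial_if_discrete[OF P V])
qed

text \<open>For \<open>k\<close> centralising \<open>H \<inter> V\<close> and
  \<open>h \<in> H\<close>, the commutator is placed in
  \<open>P \<inter> centralizer G (P \<inter> W')\<close>, where
  \<open>P = centralizer G (H \<inter> V')\<close> and the open subgroups \<open>V'\<close> and
  \<open>W'\<close> depend on \<open>h\<close> and \<open>k\<close>. By the preceding lemma it is
  trivial.\<close>

lemma centralizer_Int_OS:
  assumes H: "locally_normal H" and V: "OS V"
  shows "centralizer G (H \<inter> V) = centralizer G H"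
proof (rule equalityI)
  show "centralizer G H \<subseteq> centralizer G (H \<inter> V)" by (intro centralizer_antimono) auto
  have HG: "H \<subseteq> carrier G" by (rule ln_subset[OF H])
  have Hsub: "subgroup H G" by (rule ln_subgroup[OF H])
  have memC: "x \<in> centralizer G (H \<inter> V) \<longleftrightarrow> x \<in> carrier G \<and> (\<forall>z\<in>H \<inter> V. cj x z = z)" for x V
    using HG by (intro mem_centralizer_iff) auto
  have ln_C: "locally_normal (centralizer G (H \<inter> V))" if "OS V" for V
    by (intro ln_centralizer ln_Int H ln_OS that)
  obtain W where W: "OS W" "\<forall>w\<in>W. \<forall>h\<in>H. cj w h \<in> H"
    using H unfolding locally_normal_def by auto
  let ?V = "\<lambda>V h. V \<inter> cj h ` V"
  have OSV: "OS (?V V h)" if "OS V" "h \<in> H" for V h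
    using that HG by (intro OS_Int OS_cj_image) auto
  \<comment> \<open>Both \<open>cj h k\<close> and \<open>k\<close> centralise
    \<open>H \<inter> ?V V h\<close>, because \<open>h\<close> normalises \<open>H\<close> and
    \<open>?V V h\<close> lies in \<open>V\<close> and in its conjugate by \<open>h\<close>.\<close>
  have comm: "cj h k \<otimes> inv k \<in> centralizer G (H \<inter> ?V V h)"
    if V: "OS V" and h: "h \<in> H" and k: "k \<in> centralizer G (H \<inter> V)" for V h k
  proof -
    have sub: "subgroup (centralizer G (H \<inter> ?V V h)) G"
      using HG by (intro subgroup_centralizer) auto
    have G: "h \<in> carrier G" "k \<in> carrier G" using h k HG memC by auto
    have "cj (cj h k) z = z" if z: "z \<in> H \<inter> ?V V h" for z
    proof -
      have zG: "z \<in> carrier G" using z HG by auto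
      have "cj (inv h) z \<in> H \<inter> V"
        using z h G zG cj_subgroup_closed[OF Hsub] subgroup.m_inv_closed[OF Hsub h]
          mem_cj_image[OF OS_subset[OF V], of h z] by auto
      then have "cj k (cj (inv h) z) = cj (inv h) z" using k memC by auto
      then show ?thesis using G zG by (simp add: cj_by_cj)
    qed
    then have "cj h k \<in> centralizer G (H \<inter> ?V V h)" using G by (simp add: memC)
    moreover have "k \<in> centralizer G (H \<inter> ?V V h)" using k by (simp add: memC)
    ultimately show ?thesis
      by (intro subgroup.m_closed[OF sub] subgroup.m_inv_closed[OF sub])
  qed
  \<comment> \<open>Since \<open>k \<in> W\<close> normalises \<open>H\<close>, the commutator lies
    in \<open>H\<close> as well, and \<open>Int_centralizer_Int_OS_trivial\<close> makes it
    trivial.\<close>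
  have near: "cj h k = k" if V: "OS V" and h: "h \<in> H" and k: "k \<in> centralizer G (H \<inter> V)" "k \<in> W" for V h k
  proof -
    have G: "h \<in> carrier G" "k \<in> carrier G" using h k HG memC by auto
    have "cj k (inv h) \<in> H" using W(2) k(2) subgroup.m_inv_closed[OF Hsub h] by auto
    then have "h \<otimes> cj k (inv h) \<in> H" by (rule subgroup.m_closed[OF Hsub h])
    then have "cj h k \<otimes> inv k \<in> H \<inter> centralizer G (H \<inter> ?V V h)"
      using comm[OF V h k(1)] G by (simp add: commutator_alt)
    then have "cj h k \<otimes> inv k = \<one>"
      unfolding Int_centralizer_Int_OS_trivial[OF H OSV[OF V h]] by simp
    then show ?thesis using G by (simp add: commutator_eq_one_iff)
  qed
  show "centralizer G (H \<inter> V) \<subseteq> centralizer G H"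
  proof
    fix k assume k: "k \<in> centralizer G (H \<inter> V)"
    then have kG: "k \<in> carrier G" by (simp add: memC)
    have "cj k h = h" if h: "h \<in> H" for h
    proof -
      have hG: "h \<in> carrier G" using h HG by auto
      let ?P = "centralizer G (H \<inter> ?V V h)" and ?W = "W \<inter> cj k ` W"
      have V': "OS (?V V h)" by (rule OSV[OF V h])
      have W': "OS ?W" using W(1) kG by (intro OS_Int OS_cj_image)
      have PG: "?P \<inter> ?W \<subseteq> carrier G" using centralizer_subset by auto
      have sub: "subgroup (centralizer G (?P \<inter> ?W)) G" by (rule subgroup_centralizer[OF PG])
      have "h \<in> centralizer G (?P \<inter> ?W)"
        using near[OF V' h] hG by (simp add: mem_centralizer_iff[OF PG])
      \<comment> \<open>Conjugation by \<open>k\<close> fixes \<open>H \<inter> ?V V h\<close>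
        pointwise, so it preserves \<open>?P\<close>, and the choice of \<open>?W\<close> keeps
        \<open>cj (inv k) z\<close> in \<open>W\<close>; \<open>near\<close> then applies to that
        element.\<close>
      moreover have "cj k (inv h) \<in> centralizer G (?P \<inter> ?W)"
      proof -
        have "cj (cj k (inv h)) z = z" if z: "z \<in> ?P \<inter> ?W" for z
        proof -
          have zG: "z \<in> carrier G" using z PG by auto
          define z' where "z' = cj (inv k) z"
          have z'G: "z' \<in> carrier G" using kG zG by (simp add: z'_def)
          have z'W: "z' \<in> W"
            using z kG zG mem_cj_image[OF OS_subset[OF W(1)], of k z] by (simp add: z'_def)
          have "cj z' x = x" if x: "x \<in> H \<inter> ?V V h" for x
          proof -
            have xG: "x \<in> carrier G" using x HG by auto
            have kx: "cj k x = x" using x k by (simp add: memC)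
            moreover have "cj z x = x" using z x by (simp add: memC)
            moreover have "cj (inv k) x = x" using cj_inv_cancel(2)[OF kG xG] kx by simp
            ultimately show ?thesis using kG zG xG by (simp add: z'_def cj_by_cj)
          qed
          then have "z' \<in> ?P" using z'G by (simp add: memC)
          then have "cj (inv h) z' = z'"
            using near[OF V' subgroup.m_inv_closed[OF Hsub h]] z'W by simp
          moreover have "cj (cj k (inv h)) z = cj k (cj (inv h) z')"
            using kG hG zG by (simp add: z'_def cj_by_cj)
          ultimately show ?thesis using kG zG by (simp add: z'_def)
        qed
        then show ?thesis using kG hG by (simp add: mem_centralizer_iff[OF PG])
      qed
      ultimately have "h \<otimes> cj k (inv h) \<in> centralizer G (?P \<inter> ?W)"
        by (rule subgroup.m_closed[OF sub])
      then have "cj h k \<otimes> inv k \<in> ?P \<inter> centralizer G (?P \<inter> ?W)"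
        using comm[OF V h k] hG kG by (simp add: commutator_alt)
      then have "cj h k \<otimes> inv k = \<one>"
        unfolding Int_centralizer_Int_OS_trivial[OF ln_C[OF V'] W'] by simp
      then show ?thesis using hG kG by (simp add: commutator_eq_one_iff cj_eq_sym)
    qed
    then show "k \<in> centralizer G H" using kG by (simp add: mem_centralizer_iff[OF HG])
  qed
qed

section \<open>Order and complements among regular subgroups\<close>

lemma Int_centralizer_trivial:
  assumes "locally_normal H"
  shows "H \<inter> centralizer G H = {\<one>}"
  using Int_centralizer_Int_OS_trivial[OF assms OS_carrier] ln_subset[OF assms]
  by (simp add: Int_absorb2)

text \<open>On an open subgroup normalising both, commutators lie in \<open>H \<inter> K\<close>, so
  small elements commute; \<open>centralizer_Int_OS\<close> then removes the smallness from
  \<open>K\<close> and from \<open>H\<close> in turn.\<close>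

lemma subset_centralizer_if_disjoint:
  assumes H: "locally_normal H" and K: "locally_normal K" and "H \<inter> K = {\<one>}"
  shows "H \<subseteq> centralizer G K"
proof -
  obtain V W where V: "OS V" "\<forall>v\<in>V. \<forall>h\<in>H. cj v h \<in> H" and W: "OS W" "\<forall>v\<in>W. \<forall>k\<in>K. cj v k \<in> K"
    using assms unfolding locally_normal_def by auto
  let ?V = "V \<inter> W"
  have OSV: "OS ?V" by (intro OS_Int V W)
  have HG: "H \<subseteq> carrier G" and KG: "K \<subseteq> carrier G" using H K by (simp_all add: ln_subset)
  have "cj h k = k" if h: "h \<in> H \<inter> ?V" and k: "k \<in> K \<inter> ?V" for h k
  proof -
    have G: "h \<in> carrier G" "k \<in> carrier G" using h k HG KG by auto
    have "cj h k \<otimes> inv k \<in> K"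
      using h k W(2) ln_subgroup[OF K] by (auto intro: subgroup.m_closed subgroup.m_inv_closed)
    moreover have "h \<otimes> cj k (inv h) \<in> H"
      using h k V(2) ln_subgroup[OF H] by (auto intro: subgroup.m_closed subgroup.m_inv_closed)
    ultimately have "cj h k \<otimes> inv k = \<one>"
      using assms(3) commutator_alt[OF G] by auto
    then show ?thesis using G by (simp add: commutator_eq_one_iff)
  qed
  then have "H \<inter> ?V \<subseteq> centralizer G (K \<inter> ?V)"
    using HG KG by (auto simp: mem_centralizer_iff le_infI1)
  then have "H \<inter> ?V \<subseteq> centralizer G K"
    using centralizer_Int_OS[OF K OSV] by simp
  then have "K \<subseteq> centralizer G (H \<inter> ?V)"
    using HG KG by (subst subset_centralizer_iff) auto
  then have "K \<subseteq> centralizer G H"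
    using centralizer_Int_OS[OF H OSV] by simp
  then show ?thesis using HG KG by (subst subset_centralizer_iff)
qed

text \<open>\<open>H\<close> commutes with \<open>centralizer G a\<close>, whose centraliser is
  \<open>a\<close>. In Boolean terms: disjoint from the complement of \<open>a\<close> means below
  \<open>a\<close>.\<close>

lemma subset_regular_if_disjoint:
  assumes "locally_normal H" "regular a" "H \<inter> centralizer G a = {\<one>}"
  shows "H \<subseteq> a"
  using subset_centralizer_if_disjoint[OF assms(1) ln_centralizer[OF regular_ln[OF assms(2)]] assms(3)] assms(2)
  by (simp add: regular_def)

lemma closedin_regular:
  assumes "regular a"
  shows "closedin T a"
  using closedin_centralizer[OF centralizer_subset, of a] assms by (simp add: regular_def)

lemma ln_nontrivial_element:
  assumes "locally_normal a" "a \<noteq> {\<one>}"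
  obtains x where "x \<in> a" "x \<noteq> \<one>" "x \<in> carrier G"
  using subgroup_eq_trivial_iff[OF ln_subgroup[OF assms(1)]] assms(2) ln_subset[OF assms(1)] by auto

lemma normal_regular:
  assumes a: "regular a" "a \<noteq> {\<one>}" and stab: "stab a = carrier G"
  shows "a = carrier G"
proof -
  obtain x where x: "x \<in> a" "x \<noteq> \<one>" "x \<in> carrier G"
    using ln_nontrivial_element[OF regular_ln[OF a(1)] a(2)] .
  have "cj g x \<in> a" if "g \<in> carrier G" for g
    using that x(1) stab by (auto simp: stab_def)
  then show ?thesis
    using closed_conjugation_invariant[OF ln_subgroup[OF regular_ln[OF a(1)]] closedin_regular[OF a(1)] x(3,2)]
    by simp
qed

lemma stab_eq_carrier:
  assumes a: "locally_normal a" and x: "x \<in> carrier G" "x \<noteq> \<one>"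
    and "\<And>g. g \<in> carrier G \<Longrightarrow> cj g x \<in> stab a"
  shows "stab a = carrier G"
  using closed_conjugation_invariant[OF OS_subgroup[OF OS_stab[OF a]] OS_closedin[OF OS_stab[OF a]] x]
    assms(4) by simp

text \<open>If \<open>k\<close> fixed every regular subgroup, it would fix all conjugates of
  \<open>a0\<close>; all conjugates of \<open>k\<close> would then fix \<open>a0\<close>, making it
  normal. A moved \<open>a\<close> yields \<open>b\<close> as a difference between \<open>a\<close>
  and its image.\<close>

lemma moved_regular:
  assumes a0: "regular a0" "a0 \<noteq> {\<one>}" "a0 \<noteq> carrier G" and k: "k \<in> carrier G" "k \<noteq> \<one>"
  shows "\<exists>b. regular b \<and> b \<noteq> {\<one>} \<and> cj k ` b \<inter> b = {\<one>}"
proof -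
  have "\<exists>a. regular a \<and> cj k ` a \<noteq> a"
  proof (rule ccontr)
    assume *: "\<nexists>a. regular a \<and> cj k ` a \<noteq> a"
    have "cj g k \<in> stab a0" if g: "g \<in> carrier G" for g
    proof -
      have "regular (cj (inv g) ` a0)" using a0(1) g by (intro regular_cj_image) auto
      then have "cj k ` cj (inv g) ` a0 = cj (inv g) ` a0" using * by auto
      then have "cj g ` cj k ` cj (inv g) ` a0 = a0"
        using g regular_subset[OF a0(1)] by simp
      then have "cj (g \<otimes> k \<otimes> inv g) ` a0 = a0"
        using g k regular_subset[OF a0(1)] by (simp add: cj_image_cj_image cj_image_subset m_assoc)
      then show ?thesis using g k by (simp add: stab_def cj_def)
    qed
    then show False
      using normal_regular[OF a0(1,2)] stab_eq_carrier[OF regular_ln[OF a0(1)] k] a0(3) by simp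
  qed
  then obtain a where a: "regular a" "cj k ` a \<noteq> a" by auto
  let ?a = "cj k ` a"
  have a': "regular ?a" by (rule regular_cj_image[OF a(1) k(1)])
  have aG: "a \<subseteq> carrier G" and a'G: "?a \<subseteq> carrier G" by (rule regular_subset[OF a(1)], rule regular_subset[OF a'])
  have aln: "locally_normal a" "locally_normal ?a" by (rule regular_ln[OF a(1)], rule regular_ln[OF a'])
  have one: "\<one> \<in> centralizer G a" "\<one> \<in> centralizer G ?a" "\<one> \<in> a" "\<one> \<in> ?a"
    using aG a'G subgroup.one_closed[OF subgroup_centralizer] subgroup.one_closed[OF ln_subgroup[OF aln(1)]]
      subgroup.one_closed[OF ln_subgroup[OF aln(2)]] by auto
  show ?thesis
  proof (cases "?a \<inter> centralizer G a = {\<one>}")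
    case False
    \<comment> \<open>This choice lies in \<open>a\<close>, while its image under \<open>k\<close>
      lies in \<open>centralizer G a\<close>.\<close>
    let ?b = "cj (inv k) ` (?a \<inter> centralizer G a)"
    have sub: "?a \<inter> centralizer G a \<subseteq> carrier G" using a'G by auto
    have "regular ?b"
      using k a(1) aln by (intro regular_cj_image regular_Int regular_centralizer) auto
    moreover have "?b \<noteq> {\<one>}" using False sub k by simp
    moreover have "cj k ` ?b \<inter> ?b = {\<one>}"
    proof -
      have "cj k ` ?b = ?a \<inter> centralizer G a" using sub k by simp
      moreover have "?b \<subseteq> cj (inv k) ` ?a" by auto
      then have "?b \<subseteq> a" using aG k by simp
      moreover have "\<one> \<in> ?b" using one k by (intro image_eqI[of _ _ \<one>]) auto
      ultimately show ?thesis using Int_centralizer_trivial[OF aln(1)] one by auto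
    qed
    ultimately show ?thesis by blast
  next
    case True
    then have sub: "?a \<subseteq> a" by (rule subset_regular_if_disjoint[OF aln(2) a(1)])
    \<comment> \<open>Now \<open>k\<close> shrinks \<open>a\<close> properly; \<open>?b\<close> is
      the part that is lost, and its image lies in \<open>?a\<close>.\<close>
    let ?b = "a \<inter> centralizer G ?a"
    have "?b \<noteq> {\<one>}"
      using subset_regular_if_disjoint[OF aln(1) a'] sub a(2) by auto
    moreover have "regular ?b"
      using a(1) aln by (intro regular_Int regular_centralizer)
    moreover have "cj k ` ?b \<inter> ?b = {\<one>}"
    proof -
      have "\<one> \<in> cj k ` ?b" using one k by (intro image_eqI[of _ _ \<one>]) auto
      moreover have "cj k ` ?b \<subseteq> ?a" by auto
      ultimately show ?thesis using Int_centralizer_trivial[OF aln(2)] one by auto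
    qed
    ultimately show ?thesis by blast
  qed
qed

section \<open>The hypothesis on the centraliser lattice\<close>

lemma lattice_infinity_eq: "lattice_infinity G T = lattice_class G T (carrier G)"
proof -
  obtain U where "OS U" "compactin T U" using exists_compact_open by auto
  then show ?thesis
    by (auto simp: lattice_infinity_def lattice_class_OS[OF OS_carrier] open_subgroup_def
        lattice_class_OS[unfolded open_subgroup_def])
qed

text \<open>Otherwise every centraliser in question is \<open>{\<one>}\<close> or
  \<open>carrier G\<close>. Both occur, as centralisers of \<open>carrier G\<close> and of
  \<open>{\<one>}\<close>, so the lattice would consist of exactly the two excluded classes.\<close>

lemma exists_proper_regular:
  assumes "centralizer_lattice G T \<noteq> {lattice_zero G T, lattice_infinity G T}"
  shows "\<exists>a. regular a \<and> a \<noteq> {\<one>} \<and> a \<noteq> carrier G"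
proof (rule ccontr)
  assume *: "\<nexists>a. regular a \<and> a \<noteq> {\<one>} \<and> a \<noteq> carrier G"
  have C: "centralizer G K = {\<one>} \<or> centralizer G K = carrier G" if "K \<in> closed_locally_normal G T" for K
    using * regular_centralizer[of K] that by (auto simp: closed_locally_normal_iff)
  have "x = \<one>" if "x \<in> centralizer G (carrier G)" for x
    using that by (intro open_centralizer_trivial[OF _ OS_carrier]) (auto simp: mem_centralizer_iff)
  moreover have "\<one> \<in> centralizer G (carrier G)" by (auto simp: centralizer_def)
  ultimately have CG: "centralizer G (carrier G) = {\<one>}" by blast
  have C1: "centralizer G {\<one>} = carrier G" by (auto simp: centralizer_def)
  have "carrier G \<in> closed_locally_normal G T" "{\<one>} \<in> closed_locally_normal G T"
    using OS_closedin[OF OS_carrier] ln_OS[OF OS_carrier] ln_centralizer[OF ln_OS[OF OS_carrier]]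
      closedin_centralizer[OF subset_refl]
    by (simp_all add: closed_locally_normal_iff CG)
  then have "centralizer_lattice G T = {lattice_class G T {\<one>}, lattice_class G T (carrier G)}"
    unfolding centralizer_lattice_def using C CG C1 by (auto; metis)
  then show False
    using assms by (simp add: lattice_zero_def lattice_infinity_eq)
qed

end

section \<open>Compressible elements and ping-pong\<close>

context simple_tdlc
begin

text \<open>\<open>C\<close> consists of the elements outside \<open>U\<close> obtained from
  \<open>U\<close> by conjugating with one generator or its inverse. If all conjugates of
  \<open>a\<close> avoided it, conjugating an element of \<open>a \<inter> U\<close> step by step
  would never leave \<open>U\<close>.\<close>

lemma compact_set_met_by_conjugates:
  "\<exists>C. compactin T C \<and> \<one> \<notin> C \<and>
    (\<forall>a. locally_normal a \<and> a \<noteq> {\<one>} \<longrightarrow> (\<exists>g\<in>carrier G. cj g ` a \<inter> C \<noteq> {}))"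
proof -
  obtain U where U: "OS U" "compactin T U" using exists_compact_open by auto
  have UG: "U \<subseteq> carrier G" by (rule OS_subset[OF U(1)])
  obtain K where K: "compactin T K" "generate G K = carrier G"
    using compactly_gen unfolding compactly_generated_def by auto
  have KG: "K \<subseteq> carrier G" using compactin_subset_topspace[OF K(1)] topspace_eq_carrier by simp
  define K' where "K' = K \<union> (\<lambda>x. inv x) ` K"
  define M where "M = (\<lambda>(s, u). cj s u) ` (K' \<times> U)"
  have "compactin T K'"
    unfolding K'_def by (intro compactin_Un K(1) image_compactin[OF K(1) continuous_inv])
  moreover have "continuous_map (prod_topology T T) T (\<lambda>(s, u). cj s u)"
    unfolding case_prod_unfold by (intro continuous_map_cj continuous_map_fst continuous_map_snd)
  ultimately have M: "compactin T M"
    unfolding M_def using U(2) by (intro image_compactin[where X = "prod_topology T T"]) (auto simp: compactin_Times)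
  have closed: "closedin T (carrier G - U)"
    using OS_openin[OF U(1)] by (metis closedin_diff closedin_topspace topspace_eq_carrier)
  have "\<exists>g\<in>carrier G. cj g ` a \<inter> ((carrier G - U) \<inter> M) \<noteq> {}" if a: "locally_normal a" "a \<noteq> {\<one>}" for a
  proof (rule ccontr)
    assume *: "\<not> (\<exists>g\<in>carrier G. cj g ` a \<inter> ((carrier G - U) \<inter> M) \<noteq> {})"
    have aG: "a \<subseteq> carrier G" by (rule ln_subset[OF a(1)])
    have "a \<inter> U \<noteq> {\<one>}" using ln_trivial_if_discrete[OF a(1) U(1)] a(2) by auto
    then obtain x where x: "x \<in> a \<inter> U" "x \<noteq> \<one>"
      using ln_nontrivial_element[OF ln_Int[OF a(1) ln_OS[OF U(1)]]] by auto
    \<comment> \<open>The invariant for conjugation by words in the generators: leaving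
      \<open>U\<close> in one step would mean landing in the avoided set.\<close>
    let ?S = "{y \<in> U. \<exists>g\<in>carrier G. y \<in> cj g ` a}"
    have step: "cj s y \<in> ?S" if s: "s \<in> K'" and y: "y \<in> ?S" for s y
    proof -
      have sG: "s \<in> carrier G" using s KG by (auto simp: K'_def)
      obtain g z where g: "g \<in> carrier G" "z \<in> a" "y = cj g z" using y by auto
      have "cj s y = cj (s \<otimes> g) z" using sG g aG by (auto simp: cj_cj)
      then have m: "cj s y \<in> cj (s \<otimes> g) ` a" using g(2) by simp
      have "cj s y \<in> M" using s y by (auto simp: M_def)
      moreover have "cj s y \<in> carrier G" using sG y UG by auto
      moreover have "cj (s \<otimes> g) ` a \<inter> ((carrier G - U) \<inter> M) = {}"
        using * sG g(1) by simp
      ultimately have "cj s y \<in> U" using m by blast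
      then show ?thesis using m sG g(1) by auto
    qed
    have "cj g x \<in> ?S" if "g \<in> carrier G" for g
    proof (rule generate_cj_invariant[OF KG])
      show "g \<in> generate G K" using that K(2) by simp
      show "x \<in> ?S" using x aG by (auto intro!: bexI[of _ \<one>])
    qed (use UG step in \<open>auto simp: K'_def\<close>)
    then have "U = carrier G"
      using closed_conjugation_invariant[OF OS_subgroup[OF U(1)] OS_closedin[OF U(1)], of x] x UG by auto
    then show False using compact_OS_proper[OF U] by simp
  qed
  moreover have "compactin T ((carrier G - U) \<inter> M)"
    by (rule closed_Int_compactin[OF closed M])
  moreover have "\<one> \<notin> (carrier G - U) \<inter> M"
    using subgroup.one_closed[OF OS_subgroup[OF U(1)]] by auto
  ultimately show ?thesis by blast
qed

definition dominating :: "'a set set \<Rightarrow> bool" where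
  "dominating \<B> \<longleftrightarrow> finite \<B> \<and> (\<forall>b\<in>\<B>. regular b \<and> b \<noteq> {\<one>}) \<and>
    (\<forall>a. regular a \<and> a \<noteq> {\<one>} \<longrightarrow> (\<exists>b\<in>\<B>. \<exists>g\<in>carrier G. cj g ` b \<subseteq> a))"

text \<open>If \<open>y\<close> lies in a conjugate \<open>a'\<close> of \<open>a\<close> and moves \<open>b\<close> off itself, then
  \<open>b\<close> lies in \<open>a'\<close>, because \<open>y\<close> fixes everything that centralises \<open>a'\<close>.
  By compactness finitely many \<open>b\<close> suffice for all \<open>y\<close> in the compact set above.\<close>

lemma exists_dominating:
  assumes a0: "regular a0" "a0 \<noteq> {\<one>}" "a0 \<noteq> carrier G"
  shows "\<exists>\<B>. dominating \<B>"
proof -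
  obtain C where C: "compactin T C" "\<one> \<notin> C"
    "\<And>a. locally_normal a \<Longrightarrow> a \<noteq> {\<one>} \<Longrightarrow> \<exists>g\<in>carrier G. cj g ` a \<inter> C \<noteq> {}"
    using compact_set_met_by_conjugates by blast
  have CG: "C \<subseteq> carrier G" using compactin_subset_topspace[OF C(1)] topspace_eq_carrier by simp
  have "\<forall>k\<in>C. \<exists>b. regular b \<and> b \<noteq> {\<one>} \<and> cj k ` b \<inter> b = {\<one>}"
    using moved_regular[OF a0] CG C(2) by blast
  then obtain \<beta> where \<beta>: "\<And>k. k \<in> C \<Longrightarrow> regular (\<beta> k) \<and> \<beta> k \<noteq> {\<one>} \<and> cj k ` \<beta> k \<inter> \<beta> k = {\<one>}"
    by metis
  have stab: "OS (stab (\<beta> k))" if "k \<in> C" for k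
    using \<beta>[OF that] by (intro OS_stab regular_ln) simp
  have "k \<in> (\<otimes>) k ` stab (\<beta> k)" if "k \<in> C" for k
    using that CG subgroup.one_closed[OF OS_subgroup[OF stab[OF that]]] by (intro image_eqI[of _ _ \<one>]) auto
  \<comment> \<open>All elements of the coset of \<open>stab (\<beta> k)\<close> through
    \<open>k\<close> map \<open>\<beta> k\<close> onto the same subgroup, so
    \<open>\<beta> k\<close> serves for an open neighbourhood of \<open>k\<close>.\<close>
  then have "C \<subseteq> (\<Union>k\<in>C. (\<otimes>) k ` stab (\<beta> k))" by blast
  moreover have "openin T ((\<otimes>) k ` stab (\<beta> k))" if "k \<in> C" for k
    using openin_left_translate[OF OS_openin[OF stab[OF that]]] that CG by auto
  ultimately obtain J where J: "finite J" "J \<subseteq> C" "C \<subseteq> (\<Union>k\<in>J. (\<otimes>) k ` stab (\<beta> k))"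
    using compactin_finite_subcover[OF C(1), of C "\<lambda>k. (\<otimes>) k ` stab (\<beta> k)"] by auto
  have "\<exists>b\<in>\<beta> ` J. \<exists>g\<in>carrier G. cj g ` b \<subseteq> a" if a: "regular a" "a \<noteq> {\<one>}" for a
  proof -
    obtain g y where g: "g \<in> carrier G" and y: "y \<in> cj g ` a" "y \<in> C"
      using C(3)[OF regular_ln[OF a(1)] a(2)] by auto
    obtain k n where k: "k \<in> J" "n \<in> stab (\<beta> k)" "y = k \<otimes> n" using J(3) y(2) by auto
    have kC: "k \<in> C" using k(1) J(2) by auto
    have kG: "k \<in> carrier G" "n \<in> carrier G" using kC CG k(2) by (auto simp: stab_def)
    let ?b = "\<beta> k" and ?a = "cj g ` a"
    have b: "regular ?b" "cj k ` ?b \<inter> ?b = {\<one>}" using \<beta>[OF kC] by auto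
    have bG: "?b \<subseteq> carrier G" by (rule regular_subset[OF b(1)])
    have a': "regular ?a" by (rule regular_cj_image[OF a(1) g])
    have yb: "cj y ` ?b = cj k ` ?b"
      using k(2) bG kG by (simp add: k(3) cj_image_cj_image[symmetric]) (simp add: stab_def)
    have "?b \<inter> centralizer G ?a = {\<one>}"
    proof -
      have "z = \<one>" if z: "z \<in> ?b \<inter> centralizer G ?a" for z
      proof -
        have "cj z y = y"
          using z y(1) by (auto simp: mem_centralizer_iff[OF regular_subset[OF a']])
        then have "cj y z = z" using z y(2) CG bG by (subst cj_eq_sym) auto
        then have "z \<in> cj y ` ?b" using z by (intro image_eqI[of _ _ z]) auto
        then show ?thesis using z b(2) yb by auto
      qed
      moreover have "subgroup (?b \<inter> centralizer G ?a) G"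
        by (intro subgroup_Int ln_subgroup regular_ln b(1) regular_centralizer a')
      ultimately show ?thesis using subgroup_eq_trivial_iff by blast
    qed
    then have "?b \<subseteq> ?a" by (rule subset_regular_if_disjoint[OF regular_ln[OF b(1)] a'])
    then have "cj (inv g) ` ?b \<subseteq> cj (inv g) ` ?a" by (rule image_mono)
    then show ?thesis
      using g regular_subset[OF a(1)] k(1) by (intro bexI[of _ ?b] bexI[of _ "inv g"]) auto
  qed
  then have "dominating (\<beta> ` J)"
    using J \<beta> unfolding dominating_def by auto
  then show ?thesis by blast
qed

text \<open>In a dominating set of least cardinality no element contains a conjugate of another one.\<close>

lemma exists_compressible:
  assumes a0: "regular a0" "a0 \<noteq> {\<one>}" "a0 \<noteq> carrier G"
  shows "\<exists>b. regular b \<and> b \<noteq> {\<one>} \<and>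
    (\<forall>a. regular a \<and> a \<noteq> {\<one>} \<and> a \<subseteq> b \<longrightarrow> (\<exists>g\<in>carrier G. cj g ` b \<subseteq> a))"
proof -
  obtain \<B> where \<B>: "dominating \<B>" "\<And>\<B>'. dominating \<B>' \<Longrightarrow> card \<B> \<le> card \<B>'"
    using exists_dominating[OF a0] ex_has_least_nat[of dominating _ card] by blast
  have dom: "\<exists>b\<in>\<B>. \<exists>g\<in>carrier G. cj g ` b \<subseteq> a" if "regular a" "a \<noteq> {\<one>}" for a
    using \<B>(1) that unfolding dominating_def by simp
  have fin: "finite \<B>" using \<B>(1) by (simp add: dominating_def)
  obtain b where b: "b \<in> \<B>" using dom[OF a0(1,2)] by blast
  have reg: "regular b" "b \<noteq> {\<one>}" using \<B>(1) b by (auto simp: dominating_def)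
  have "\<exists>g\<in>carrier G. cj g ` b \<subseteq> a" if a: "regular a" "a \<noteq> {\<one>}" "a \<subseteq> b" for a
  proof -
    obtain b' g where b': "b' \<in> \<B>" "g \<in> carrier G" "cj g ` b' \<subseteq> a" using dom[OF a(1,2)] by blast
    have "b' = b"
    proof (rule ccontr)
      assume ne: "b' \<noteq> b"
      have "\<exists>c\<in>\<B> - {b}. \<exists>g\<in>carrier G. cj g ` c \<subseteq> x" if x: "regular x" "x \<noteq> {\<one>}" for x
      proof -
        obtain c h where c: "c \<in> \<B>" "h \<in> carrier G" "cj h ` c \<subseteq> x" using dom[OF x] by blast
        show ?thesis
        proof (cases "c = b")
          case True
          have b'G: "b' \<subseteq> carrier G"
            using \<B>(1) b'(1) regular_subset by (auto simp: dominating_def)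
          have "cj h ` cj g ` b' \<subseteq> cj h ` b" using b'(3) a(3) by (intro image_mono) auto
          then have "cj (h \<otimes> g) ` b' \<subseteq> x" using c True b' b'G by (simp add: cj_image_cj_image)
          then show ?thesis using b' ne c(2) by (intro bexI[of _ b'] bexI[of _ "h \<otimes> g"]) auto
        next
          case False
          then show ?thesis using c by blast
        qed
      qed
      then have "dominating (\<B> - {b})" using \<B>(1) by (simp add: dominating_def)
      then have "card \<B> \<le> card (\<B> - {b})" by (rule \<B>(2))
      then show False using card_Diff1_less[OF fin b] by simp
    qed
    then show ?thesis using b' by blast
  qed
  then show ?thesis using reg by blast
qed

text \<open>Distinct conjugates of an atom would be disjoint and hence commute, so that all of them would
  normalise the atom.\<close>

lemma regular_not_atom:
  assumes a0: "regular a0" "a0 \<noteq> {\<one>}" "a0 \<noteq> carrier G" and b: "regular b" "b \<noteq> {\<one>}"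
  shows "\<exists>a. regular a \<and> a \<noteq> {\<one>} \<and> a \<subseteq> b \<and> a \<noteq> b"
proof (rule ccontr)
  assume "\<nexists>a. regular a \<and> a \<noteq> {\<one>} \<and> a \<subseteq> b \<and> a \<noteq> b"
  then have atom: "a = b" if "regular a" "a \<noteq> {\<one>}" "a \<subseteq> b" for a
    using that by blast
  have bG: "b \<subseteq> carrier G" by (rule regular_subset[OF b(1)])
  have bln: "locally_normal b" by (rule regular_ln[OF b(1)])
  have le: "b \<subseteq> cj g ` b" if "g \<in> carrier G" "cj g ` b \<inter> b \<noteq> {\<one>}" for g
    using atom[of "cj g ` b \<inter> b"] that regular_Int[OF regular_cj_image[OF b(1) that(1)] b(1)] by auto
  have conj: "cj g ` b = b" if g: "g \<in> carrier G" "cj g ` b \<inter> b \<noteq> {\<one>}" for g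
  proof
    show "b \<subseteq> cj g ` b" by (rule le[OF g])
    have "cj (inv g) ` (cj g ` b \<inter> b) = b \<inter> cj (inv g) ` b"
      using g(1) bG by (simp add: cj_image_Int cj_image_subset)
    moreover have "cj (inv g) ` (cj g ` b \<inter> b) \<noteq> {\<one>}"
      using g bG by (subst cj_image_trivial_iff) auto
    ultimately have "b \<subseteq> cj (inv g) ` b"
      using le[of "inv g"] g(1) by (simp add: Int_commute)
    then have "cj g ` b \<subseteq> cj g ` cj (inv g) ` b" by (rule image_mono)
    then show "cj g ` b \<subseteq> b" using g(1) bG by simp
  qed
  obtain x where x: "x \<in> b" "x \<noteq> \<one>" "x \<in> carrier G" using ln_nontrivial_element[OF bln b(2)] .
  have "cj g x \<in> stab b" if g: "g \<in> carrier G" for g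
  proof (cases "cj g ` b \<inter> b = {\<one>}")
    case True
    then have "cj g ` b \<subseteq> centralizer G b"
      by (intro subset_centralizer_if_disjoint ln_cj_image bln g)
    then have "cj g x \<in> centralizer G b" using x(1) by auto
    then have "\<forall>z\<in>b. cj (cj g x) z = z" by (simp add: mem_centralizer_iff[OF bG])
    then have "cj (cj g x) ` b = b" by (simp add: image_def)
    then show ?thesis using g x(3) by (simp add: stab_def)
  next
    case False
    then have y: "cj g x \<in> b" using conj[OF g] x(1) by auto
    have "\<forall>v\<in>b. \<forall>h\<in>b. cj v h \<in> b" using cj_subgroup_closed[OF ln_subgroup[OF bln]] by auto
    moreover have "inv (cj g x) \<in> b" using subgroup.m_inv_closed[OF ln_subgroup[OF bln] y] .
    ultimately have "cj (cj g x) ` b = b"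
      using y bG g x(3) by (auto simp: mem_cj_image subset_iff)
    then show ?thesis using g x(3) by (simp add: stab_def)
  qed
  \<comment> \<open>The atom \<open>b\<close> is now normal, so it is all of \<open>G\<close>, and
    \<open>a0\<close> would be a proper non-trivial element below it.\<close>
  then have "b = carrier G"
    using normal_regular[OF b] stab_eq_carrier[OF bln x(3,2)] by simp
  then show False using atom[OF a0(1,2)] a0(3) regular_subset[OF a0(1)] by simp
qed

text \<open>An element \<open>a\<close> strictly below \<open>b\<close> has a non-trivial relative
  complement \<open>b \<inter> centralizer G a\<close>; compressibility conjugates \<open>b\<close>
  into each of the two.\<close>

lemma exists_schottky_pair:
  assumes a0: "regular a0" "a0 \<noteq> {\<one>}" "a0 \<noteq> carrier G"
  shows "\<exists>b g h. locally_normal b \<and> b \<noteq> {\<one>} \<and> g \<in> carrier G \<and> h \<in> carrier G \<and>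
    cj g ` b \<subseteq> b \<and> cj h ` b \<subseteq> b \<and> cj g ` b \<inter> cj h ` b = {\<one>}"
proof -
  obtain b where b: "regular b" "b \<noteq> {\<one>}"
    "\<forall>a. regular a \<and> a \<noteq> {\<one>} \<and> a \<subseteq> b \<longrightarrow> (\<exists>g\<in>carrier G. cj g ` b \<subseteq> a)"
    using exists_compressible[OF a0] by (elim exE conjE)
  obtain a where a: "regular a" "a \<noteq> {\<one>}" "a \<subseteq> b" "a \<noteq> b"
    using regular_not_atom[OF a0 b(1,2)] by (elim exE conjE)
  let ?a = "b \<inter> centralizer G a"
  have "?a \<noteq> {\<one>}"
    using subset_regular_if_disjoint[OF regular_ln[OF b(1)] a(1)] a(3,4) by blast
  moreover have "regular ?a"
    by (intro regular_Int regular_centralizer regular_ln a(1) b(1))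
  ultimately obtain h where h: "h \<in> carrier G" "cj h ` b \<subseteq> ?a"
    using spec[OF b(3), of ?a] by auto
  obtain g where g: "g \<in> carrier G" "cj g ` b \<subseteq> a"
    using spec[OF b(3), of a] a by auto
  have "\<one> \<in> b" by (rule subgroup.one_closed[OF ln_subgroup[OF regular_ln[OF b(1)]]])
  then have "\<one> \<in> cj g ` b" "\<one> \<in> cj h ` b"
    using g(1) h(1) by (auto intro!: image_eqI[of _ _ \<one>])
  moreover have "cj g ` b \<inter> cj h ` b \<subseteq> {\<one>}"
    using g(2) h(2) Int_centralizer_trivial[OF regular_ln[OF a(1)]] by blast
  ultimately have "cj g ` b \<inter> cj h ` b = {\<one>}" by blast
  then show ?thesis
    using b(1,2) g h a(3) regular_ln by (intro exI[of _ b] exI[of _ g] exI[of _ h]) auto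
qed

end

section \<open>Free discrete semigroups from ping-pong\<close>

context topological_group
begin

text \<open>A word can be recovered from the image of \<open>b\<close> under it, which lies inside
  the image under the first letter. This gives freeness, and also discreteness, since elements with
  the same image of \<open>b\<close> form a coset of the open subgroup
  \<open>stab b\<close>.\<close>

lemma schottky_free_discrete:
  assumes b: "locally_normal b" "b \<noteq> {\<one>}" and G: "g \<in> carrier G" "h \<in> carrier G"
    and sub: "cj g ` b \<subseteq> b" "cj h ` b \<subseteq> b" and disj: "cj g ` b \<inter> cj h ` b = {\<one>}"
  shows "\<exists>S. free_subsemigroup G S \<and> nonabelian G S \<and> discrete_subset T S"
proof -
  have bG: "b \<subseteq> carrier G" by (rule ln_subset[OF b(1)])
  define X where "X = {g, h}"
  define ev where "ev ws = foldr (\<otimes>) ws \<one>" for ws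
  have XG: "x \<in> carrier G" if "x \<in> X" for x using that G by (auto simp: X_def)
  have ev_closed: "ev ws \<in> carrier G" if "ws \<in> lists X" for ws
    using that by (induction ws) (auto simp: ev_def XG)
  have ev_Cons: "ev (w # ws) = w \<otimes> ev ws" for w ws by (simp add: ev_def)
  have ev_append: "ev (v @ w) = ev v \<otimes> ev w" if "v \<in> lists X" "w \<in> lists X" for v w
    using that
  proof (induction v)
    case Nil
    then show ?case using ev_closed[of w] by (simp add: ev_def)
  next
    case (Cons x v)
    then show ?case using XG ev_closed by (simp add: ev_Cons m_assoc)
  qed
  have Xsub: "cj x ` b \<subseteq> b" if "x \<in> X" for x using that sub by (auto simp: X_def)
  have Xdisj: "cj x ` b \<inter> cj y ` b = {\<one>}" if "x \<in> X" "y \<in> X" "x \<noteq> y" for x y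
    using that disj by (auto simp: X_def Int_commute)
  have ev_image: "cj (ev (x # ws)) ` b = cj x ` cj (ev ws) ` b" if "x \<in> X" "ws \<in> lists X" for x ws
    using XG[OF that(1)] ev_closed[OF that(2)] bG by (simp add: ev_Cons cj_image_cj_image)
  have ev_sub: "cj (ev ws) ` b \<subseteq> b" if "ws \<in> lists X" for ws
    using that
  proof (induction ws)
    case Nil
    then show ?case using bG by (simp add: ev_def)
  next
    case (Cons x ws)
    have "cj x ` cj (ev ws) ` b \<subseteq> cj x ` b" by (rule image_mono[OF Cons.IH])
    then show ?case using Xsub Cons.hyps ev_image by auto
  qed
  have nontriv: "cj x ` b \<noteq> {\<one>}" if "x \<in> carrier G" for x
    using that b(2) bG by simp
  \<comment> \<open>Otherwise \<open>b\<close> would lie in its image under \<open>x\<close>, and so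
    would the image under the other letter, although the two images meet trivially.\<close>
  have not_sub: "cj (ev (x # ws)) ` b \<noteq> b" if "x \<in> X" "ws \<in> lists X" for x ws
  proof
    assume eq: "cj (ev (x # ws)) ` b = b"
    have "cj (ev (x # ws)) ` b \<subseteq> cj x ` b"
      unfolding ev_image[OF that] by (rule image_mono[OF ev_sub[OF that(2)]])
    then have bx: "b \<subseteq> cj x ` b" using eq by simp
    show False
    proof (cases "g = h")
      case True
      then show False using disj nontriv[OF G(1)] by simp
    next
      case False
      then obtain y where y: "y \<in> X" "y \<noteq> x" by (auto simp: X_def)
      have "cj y ` b \<subseteq> cj x ` b" by (rule order_trans[OF Xsub[OF y(1)] bx])
      then have "cj y ` b = {\<one>}"
        using Xdisj[OF that(1) y(1) y(2)[symmetric]] by (simp add: inf_absorb2)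
      then show False using nontriv[OF XG[OF y(1)]] by simp
    qed
  qed
  \<comment> \<open>Equal first letters cancel; different ones would force the common image into
    \<open>{\<one>}\<close>. The empty word is compared by \<open>not_sub\<close>.\<close>
  have image_inj: "v = w" if "v \<in> lists X" "w \<in> lists X" "cj (ev v) ` b = cj (ev w) ` b" for v w
    using that
  proof (induction v arbitrary: w)
    case Nil
    show ?case
    proof (cases w)
      case (Cons x ws)
      then show ?thesis using not_sub[of x ws] Nil bG by (auto simp: ev_def)
    qed simp
  next
    case (Cons x v)
    show ?case
    proof (cases w)
      case Nil
      then show ?thesis using not_sub[of x v] Cons bG by (auto simp: ev_def)
    next
      case (Cons y ws)
      have xy: "x \<in> X" "v \<in> lists X" "y \<in> X" "ws \<in> lists X"
        using Cons.prems Cons.hyps \<open>w = y # ws\<close> by auto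
      have eq: "cj x ` cj (ev v) ` b = cj y ` cj (ev ws) ` b"
        using Cons.prems(2) \<open>w = y # ws\<close> ev_image xy by simp
      have vG: "cj (ev v) ` b \<subseteq> carrier G" "cj (ev ws) ` b \<subseteq> carrier G"
        by (rule cj_image_subset[OF bG ev_closed[OF xy(2)]], rule cj_image_subset[OF bG ev_closed[OF xy(4)]])
      show ?thesis
      proof (cases "x = y")
        case True
        then have "cj (inv x) ` cj x ` cj (ev v) ` b = cj (inv x) ` cj x ` cj (ev ws) ` b"
          using eq by simp
        then have "cj (ev v) ` b = cj (ev ws) ` b"
          using XG[OF xy(1)] vG by simp
        then show ?thesis using Cons.IH[OF xy(4)] True \<open>w = y # ws\<close> by simp
      next
        case False
        have "cj x ` cj (ev v) ` b \<subseteq> cj x ` b" "cj y ` cj (ev ws) ` b \<subseteq> cj y ` b"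
          using ev_sub xy by (auto intro!: image_mono)
        then have "cj x ` cj (ev v) ` b \<subseteq> cj x ` b \<inter> cj y ` b"
          unfolding eq by (rule Int_greatest)
        then have "cj x ` cj (ev v) ` b \<subseteq> {\<one>}"
          unfolding Xdisj[OF xy(1,3) False] .
        moreover have "subgroup (cj x ` cj (ev v) ` b) G"
          using XG ev_closed xy ln_subgroup[OF b(1)] by (intro subgroup_cj_image) auto
        ultimately have "cj x ` cj (ev v) ` b = {\<one>}"
          using subgroup.one_closed by blast
        then show ?thesis
          using XG[OF xy(1)] ev_closed[OF xy(2)] vG(1) bG b(2) by simp
      qed
    qed
  qed
  define S where "S = ev ` (lists X - {[]})"
  have inj: "inj_on ev (lists X - {[]})"
    by (rule inj_onI) (auto intro: image_inj)
  have evX: "ev [x] = x" if "x \<in> X" for x using XG[OF that] by (simp add: ev_def)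
  have XS: "X \<subseteq> S"
  proof
    fix x assume "x \<in> X"
    then show "x \<in> S" using evX unfolding S_def by (intro image_eqI[of _ _ "[x]"]) auto
  qed
  have "subsemigroup G S"
    unfolding subsemigroup_def
  proof (intro conjI ballI)
    show "S \<subseteq> carrier G" using ev_closed by (auto simp: S_def)
    fix x y assume "x \<in> S" "y \<in> S"
    then obtain v w where "v \<in> lists X - {[]}" "x = ev v" "w \<in> lists X - {[]}" "y = ev w"
      by (auto simp: S_def)
    then show "x \<otimes> y \<in> S"
      using ev_append[of v w] unfolding S_def by (intro image_eqI[of _ _ "v @ w"]) auto
  qed
  moreover have "bij_betw (\<lambda>ws. foldr (\<otimes>) ws \<one>) (lists X - {[]}) S"
    using inj unfolding S_def bij_betw_def ev_def by simp
  ultimately have "free_subsemigroup G S"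
    using XS unfolding free_subsemigroup_def by auto
  moreover have "nonabelian G S"
  proof -
    have X: "g \<in> X" "h \<in> X" by (auto simp: X_def)
    have "g \<noteq> h" using disj nontriv[OF G(1)] by auto
    then have "ev [g, h] \<noteq> ev [h, g]" using image_inj[of "[g, h]" "[h, g]"] X by auto
    then have "g \<otimes> h \<noteq> h \<otimes> g" using G by (simp add: ev_def)
    then show ?thesis using X XS unfolding nonabelian_def by blast
  qed
  moreover have "discrete_subset T S"
    unfolding discrete_subset_def
  proof (rule sym, subst discrete_topology_unique, intro conjI ballI)
    have "S \<subseteq> carrier G" using ev_closed by (auto simp: S_def)
    then show "topspace (subtopology T S) = S" by (auto simp: topspace_eq_carrier)
    fix s assume s: "s \<in> S"
    then obtain v where v: "v \<in> lists X" "s = ev v" by (auto simp: S_def)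
    have sG: "s \<in> carrier G" using v ev_closed by simp
    have "s' = s" if s': "s' \<in> S" "s' \<in> (\<otimes>) s ` stab b" for s'
    proof -
      obtain w where w: "w \<in> lists X" "s' = ev w" using s' by (auto simp: S_def)
      obtain n where n: "n \<in> stab b" "s' = s \<otimes> n" using s' by auto
      have nb: "n \<in> carrier G" "cj n ` b = b" using n(1) by (simp_all add: stab_def)
      have "cj s' ` b = cj s ` b"
        using cj_image_cj_image[OF bG sG nb(1)] nb(2) n(2) by simp
      then show ?thesis using image_inj[OF w(1) v(1)] w(2) v(2) by simp
    qed
    moreover have "s \<in> (\<otimes>) s ` stab b"
      using sG subgroup.one_closed[OF subgroup_stab[OF bG]] by (intro image_eqI[of _ _ \<one>]) auto
    ultimately have "{s} = ((\<otimes>) s ` stab b) \<inter> S" using s by blast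
    then show "openin (subtopology T S) {s}"
      using openin_left_translate[OF OS_openin[OF OS_stab[OF b(1)]] sG]
      unfolding openin_subtopology by (intro exI[of _ "(\<otimes>) s ` stab b"]) simp
  qed
  ultimately show ?thesis by blast
qed

end

theorem corollary11:
  fixes G :: "('a, 'b) monoid_scheme" and T :: "'a topology"
  assumes "class_S G T"
    and "centralizer_lattice G T \<noteq> {lattice_zero G T, lattice_infinity G T}"
  shows "\<exists>S. free_subsemigroup G S \<and> nonabelian G S \<and> discrete_subset T S"
proof -
  interpret simple_tdlc G T
    using assms(1)
    by (simp add: class_S_def tdlc_group_def simple_tdlc_def tdlc_def tdlc_axioms_def simple_tdlc_axioms_def)
  obtain a where "regular a" "a \<noteq> {\<one>\<^bsub>G\<^esub>}" "a \<noteq> carrier G"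
    using exists_proper_regular[OF assms(2)] by blast
  from exists_schottky_pair[OF this] show ?thesis
    by (elim exE conjE) (rule schottky_free_discrete)
qed

end
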